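(* Let $X=\{X^{(0)},X^{(1)},\ldots\}$ be a time-homogeneous Harris ergodic Markov chain on $\mathsf{X}\subseteq\mathbb{R}^d$ with invariant distribution $\pi$. Let $\theta_\pi\in\mathbb{R}$ be a feature of $\pi$ and let $\lambda_\theta$ be the associated posterior standard deviation. For $n\ge 1$ let $\hat\theta_n$, $\hat\sigma_n$, $\hat\lambda_n$ be real-valued estimators computed from the first $n$ observations of the chain, with $\hat\sigma_n\ge 0$ and $\hat\lambda_n\ge 0$. Let $\delta\in(0,1)$, and let $p:\{1,2,\ldots\}\to(0,\infty)$ be a monotonically decreasing function with $p(n)=o(n^{-1/2})$ as $n\to\infty$. Suppose that $\hat\theta_n$ satisfies a functional central limit theorem with centering $\theta_\pi$ and asymptotic variance $\sigma_\theta^2\in(0,\infty)$ (as defined in the context), and that $0<\lambda_\theta<\infty$. Suppose also that $\hat\lambda_n\to\lambda_\theta$ with probability 1 and $\hat\sigma_n\to\sigma_\theta$ with probability 1 as $n\to\infty$. For $\epsilon>0$ define $$T_3(\epsilon)=\inf\left\{n\ge 1:\ 2z_{\delta/2}\frac{\hat\sigma_n}{\sqrt n}+p(n)\le \epsilon\,\hat\lambda_n\right\}.$$ Then for every $\epsilon>0$ the simulation terminates with probability 1, that is, $\Pr(T_3(\epsilon)<\infty)=1$, and $$\Pr\left(\theta_\pi\in C[T_3(\epsilon)]\right)\to 1-\delta\quad\text{as }\epsilon\to 0.$$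
   Context: Critical value: $z_{\delta/2}$ is the critical value of the standard Normal distribution, $\Pr(Z>z_{\delta/2})=\delta/2$ for $Z\sim N(0,1)$. Confidence interval: for $n\ge 1$, $$C[n]=\left(\hat\theta_n-z_{\delta/2}\frac{\hat\sigma_n}{\sqrt n},\ \hat\theta_n+z_{\delta/2}\frac{\hat\sigma_n}{\sqrt n}\right),$$ and $C[T_3(\epsilon)]$ is this interval evaluated at the random index $n=T_3(\epsilon)$ (on the probability-zero event $T_3(\epsilon)=\infty$ it may be defined arbitrarily). The central limit theorem for the Monte Carlo error is $\sqrt n(\hat\theta_n-\theta_\pi)\to N(0,\sigma_\theta^2)$ in distribution as $n\to\infty$, with $\sigma_\theta^2\in(0,\infty)$. The functional central limit theorem (FCLT) is its process-level version: the processes $$t\mapsto \frac{\lfloor nt\rfloor}{\sqrt n}\left(\hat\theta_{\lfloor nt\rfloor}-\theta_\pi\right),\qquad t\ge 0$$ (set equal to $0$ when $\lfloor nt\rfloor=0$) converge in distribution, as $n\to\infty$, in the Skorokhod space $D[0,\infty)$ to $\sigma_\theta B$, where $B$ is a standard Brownian motion. Taking $t=1$ recovers the central limit theorem. The posterior standard deviation $\lambda_\theta$ is a deterministic constant attached to the target parameter (for instance, if $\theta_\pi=E_\pi[g(X)]$ then $\lambda_\theta^2=\mathrm{Var}_\pi[g]$). In general $\lambda_\theta^2\ne\sigma_\theta^2$. The only properties of $\lambda_\theta$ used are those stated in the claim. The function $p$ does not depend on $\epsilon$. *)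

theory Defs
  imports "HOL-Probability.Probability"
begin

section \<open>Harris ergodic Markov chains\<close>

text \<open>
  A Markov kernel on a measurable space \<open>E\<close> is a measurable map from \<open>E\<close> to \<open>prob_algebra E\<close>.
\<close>

primrec nstep_kernel :: "'a measure \<Rightarrow> ('a \<Rightarrow> 'a measure) \<Rightarrow> nat \<Rightarrow> 'a \<Rightarrow> 'a measure" where
  "nstep_kernel E P 0 = return E"
| "nstep_kernel E P (Suc n) = (\<lambda>x. P x \<bind> nstep_kernel E P n)"

text \<open>
  The initial distribution is left arbitrary. The conditional expectation is taken with respect
  to the sigma-algebra generated by \<open>X 0, \<dots>, X n\<close>.
\<close>

definition markov_chain ::
    "'w measure \<Rightarrow> 'a measure \<Rightarrow> ('a \<Rightarrow> 'a measure) \<Rightarrow> (nat \<Rightarrow> 'w \<Rightarrow> 'a) \<Rightarrow> bool" where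
  "markov_chain M E P X \<longleftrightarrow>
     prob_space M \<and> P \<in> E \<rightarrow>\<^sub>M prob_algebra E \<and> (\<forall>n. X n \<in> M \<rightarrow>\<^sub>M E) \<and>
     (\<forall>n. \<forall>A\<in>sets E. AE \<omega> in M.
        real_cond_exp M
          (vimage_algebra (space M) (\<lambda>\<omega>. \<lambda>i\<in>{..n}. X i \<omega>) (PiM {..n} (\<lambda>_. E)))
          (\<lambda>\<omega>. indicator A (X (Suc n) \<omega>)) \<omega>
        = measure (P (X n \<omega>)) A)"

definition path_step ::
    "'a measure \<Rightarrow> ('a \<Rightarrow> 'a measure) \<Rightarrow> 'a \<Rightarrow> nat \<Rightarrow> (nat \<Rightarrow> 'a) \<Rightarrow> 'a measure" where
  "path_step E P x n \<omega> = (if n = 0 then return E x else P (\<omega> (n - 1)))"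

lemma Ionescu_Tulcea_path_step:
  assumes P [measurable]: "P \<in> E \<rightarrow>\<^sub>M prob_algebra E" and x: "x \<in> space E"
  shows "Ionescu_Tulcea (path_step E P x) (\<lambda>_. E)"
proof (rule Ionescu_Tulcea.intro)
  fix n
  show "path_step E P x n \<in> PiM {0..<n} (\<lambda>_. E) \<rightarrow>\<^sub>M subprob_algebra E"
  proof (cases "n = 0")
    case True
    then show ?thesis
      using measurable_const[OF measurable_space[OF return_measurable x]]
      by (simp add: path_step_def[abs_def])
  next
    case False
    have "(\<lambda>\<omega>. \<omega> (n - 1)) \<in> PiM {0..<n} (\<lambda>_. E) \<rightarrow>\<^sub>M E"
      using False by (intro measurable_component_singleton) simp
    from measurable_compose[OF this measurable_prob_algebraD[OF P]]
    have "(\<lambda>\<omega>. P (\<omega> (n - 1))) \<in> PiM {0..<n} (\<lambda>_. E) \<rightarrow>\<^sub>M subprob_algebra E" .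
    then show ?thesis
      using False by (simp add: path_step_def[abs_def])
  qed
next
  fix n :: nat and \<omega> assume \<omega>: "\<omega> \<in> space (PiM {0..<n} (\<lambda>_. E))"
  show "prob_space (path_step E P x n \<omega>)"
  proof (cases "n = 0")
    case True
    then show ?thesis
      using x by (simp add: path_step_def prob_space_return)
  next
    case False
    then have "\<omega> (n - 1) \<in> space E"
      using \<omega> by (auto simp: space_PiM PiE_iff)
    then have "P (\<omega> (n - 1)) \<in> space (prob_algebra E)"
      using P by (rule measurable_space[rotated])
    then show ?thesis
      using False by (simp add: path_step_def space_prob_algebra)
  qed
qed

text \<open>
  The law on path space of the chain with transition kernel \<open>P\<close> started at the point \<open>x\<close>,
  usually written \<open>P\<^sub>x\<close>, obtained from the Ionescu-Tulcea theorem.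
\<close>

definition path_measure ::
    "'a measure \<Rightarrow> ('a \<Rightarrow> 'a measure) \<Rightarrow> 'a \<Rightarrow> (nat \<Rightarrow> 'a) measure" where
  "path_measure E P x =
     projective_family.lim UNIV (Ionescu_Tulcea.CI (path_step E P x) (\<lambda>_. E)) (\<lambda>_. E)"

definition invariant_distribution :: "'a measure \<Rightarrow> ('a \<Rightarrow> 'a measure) \<Rightarrow> 'a measure \<Rightarrow> bool" where
  "invariant_distribution E P \<pi> \<longleftrightarrow> \<pi> \<in> space (prob_algebra E) \<and> \<pi> \<bind> P = \<pi>"

definition irreducible_kernel :: "'a measure \<Rightarrow> ('a \<Rightarrow> 'a measure) \<Rightarrow> bool" where
  "irreducible_kernel E P \<longleftrightarrow>
     (\<exists>\<phi>. sets \<phi> = sets E \<and> sigma_finite_measure \<phi> \<and> 0 < emeasure \<phi> (space E) \<and>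
        (\<forall>A\<in>sets E. 0 < emeasure \<phi> A \<longrightarrow>
           (\<forall>x\<in>space E. \<exists>n\<ge>1. 0 < emeasure (nstep_kernel E P n x) A)))"

text \<open>
  Aperiodicity and Harris recurrence are stated, as is usual for Markov chain Monte Carlo, for
  an irreducible kernel with invariant distribution \<open>\<pi>\<close> (Roberts and Rosenthal 2004;
  Tierney 1994); \<open>\<pi>\<close> is then a maximal irreducibility measure.
\<close>

definition aperiodic_kernel :: "'a measure \<Rightarrow> ('a \<Rightarrow> 'a measure) \<Rightarrow> 'a measure \<Rightarrow> bool" where
  "aperiodic_kernel E P \<pi> \<longleftrightarrow>
     \<not> (\<exists>k\<ge>2. \<exists>D :: nat \<Rightarrow> 'a set. (\<forall>i<k. D i \<in> sets E) \<and> disjoint_family_on D {..<k} \<and>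
          (\<forall>i<k. \<forall>x\<in>D i. measure (P x) (D (Suc i mod k)) = 1) \<and> 0 < measure \<pi> (D 0))"

definition harris_recurrent :: "'a measure \<Rightarrow> ('a \<Rightarrow> 'a measure) \<Rightarrow> 'a measure \<Rightarrow> bool" where
  "harris_recurrent E P \<pi> \<longleftrightarrow>
     (\<forall>A\<in>sets E. 0 < measure \<pi> A \<longrightarrow>
        (\<forall>x\<in>space E. AE \<omega> in path_measure E P x. \<exists>\<^sub>\<infinity>n. \<omega> n \<in> A))"

definition harris_ergodic :: "'a measure \<Rightarrow> ('a \<Rightarrow> 'a measure) \<Rightarrow> 'a measure \<Rightarrow> bool" where
  "harris_ergodic E P \<pi> \<longleftrightarrow>
     invariant_distribution E P \<pi> \<and> irreducible_kernel E P \<and>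
     aperiodic_kernel E P \<pi> \<and> harris_recurrent E P \<pi>"


section \<open>The Skorokhod space \<open>D[0, \<infinity>)\<close>\<close>

text \<open>
  Functions on \<open>[0, \<infinity>)\<close> are represented as functions on the reals that are extensional on
  \<open>{0..}\<close>.
\<close>

definition skorokhod_space :: "(real \<Rightarrow> real) set" where
  "skorokhod_space = {x \<in> extensional {0..}.
     (\<forall>t\<ge>0. (x \<longlongrightarrow> x t) (at_right t)) \<and> (\<forall>t>0. \<exists>l. (x \<longlongrightarrow> l) (at_left t))}"

text \<open>Time changes of \<open>[0, m]\<close>; being increasing bijections, they are automatically continuous.\<close>

definition time_changes :: "real \<Rightarrow> (real \<Rightarrow> real) set" where
  "time_changes m = {\<mu>. strict_mono_on {0..m} \<mu> \<and> bij_betw \<mu> {0..m} {0..m}}"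

definition time_change_bounds :: "real \<Rightarrow> (real \<Rightarrow> real) \<Rightarrow> (real \<Rightarrow> real) \<Rightarrow> real set" where
  "time_change_bounds m x y = {e. 0 < e \<and>
     (\<exists>\<mu>\<in>time_changes m. \<forall>t\<in>{0..m}. \<bar>\<mu> t - t\<bar> \<le> e \<and> \<bar>x t - y (\<mu> t)\<bar> \<le> e)}"

text \<open>
  The Skorokhod distance on \<open>D[0, m]\<close> is the infimum of \<open>time_change_bounds m x y\<close>; inserting
  \<open>1\<close> truncates it at \<open>1\<close>.
\<close>

definition skorokhod_dist_on :: "real \<Rightarrow> (real \<Rightarrow> real) \<Rightarrow> (real \<Rightarrow> real) \<Rightarrow> real" where
  "skorokhod_dist_on m x y = Inf (insert 1 (time_change_bounds m x y))"

definition taper :: "real \<Rightarrow> (real \<Rightarrow> real) \<Rightarrow> real \<Rightarrow> real" where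
  "taper m x t = max 0 (min 1 (m - t)) * x t"

text \<open>
  The metric of Billingsley (Convergence of Probability Measures, 2nd ed., Section 16), with the
  uniform size of \<open>\<mu> t - t\<close> in place of his logarithmic slopes; both metrize the Skorokhod \<open>J\<^sub>1\<close>
  topology. Time changes fix the endpoint \<open>m\<close>; tapering removes the special role this would
  otherwise give to the value at \<open>m\<close>.
\<close>

definition skorokhod_dist :: "(real \<Rightarrow> real) \<Rightarrow> (real \<Rightarrow> real) \<Rightarrow> real" where
  "skorokhod_dist x y =
     (\<Sum>k. (1/2) ^ Suc k *
        skorokhod_dist_on (real (Suc k)) (taper (real (Suc k)) x) (taper (real (Suc k)) y))"

lemma time_change_inv_into:
  assumes "\<mu> \<in> time_changes m"
  shows "inv_into {0..m} \<mu> \<in> time_changes m"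
proof -
  have mono: "strict_mono_on {0..m} \<mu>" and bij: "bij_betw \<mu> {0..m} {0..m}"
    using assms by (auto simp: time_changes_def)
  let ?\<nu> = "inv_into {0..m} \<mu>"
  have bij': "bij_betw ?\<nu> {0..m} {0..m}"
    using bij by (rule bij_betw_inv_into)
  have "strict_mono_on {0..m} ?\<nu>"
  proof (rule strict_mono_onI)
    fix r s assume rs: "r \<in> {0..m}" "s \<in> {0..m}" "r < s"
    have mem: "?\<nu> r \<in> {0..m}" "?\<nu> s \<in> {0..m}"
      using bij_betw_apply[OF bij' rs(1)] bij_betw_apply[OF bij' rs(2)] by simp_all
    have eq: "\<mu> (?\<nu> r) = r" "\<mu> (?\<nu> s) = s"
      using bij rs by (auto intro: bij_betw_inv_into_right)
    show "?\<nu> r < ?\<nu> s"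
    proof (rule ccontr)
      assume "\<not> ?\<nu> r < ?\<nu> s"
      then have "?\<nu> s < ?\<nu> r \<or> ?\<nu> s = ?\<nu> r" by auto
      then have "\<mu> (?\<nu> s) \<le> \<mu> (?\<nu> r)"
        using strict_mono_onD[OF mono mem(2,1)] by auto
      with eq rs show False by simp
    qed
  qed
  with bij' show ?thesis by (simp add: time_changes_def)
qed

lemma time_change_bounds_sym: "time_change_bounds m x y \<subseteq> time_change_bounds m y x"
proof
  fix e assume "e \<in> time_change_bounds m x y"
  then obtain \<mu> where e: "0 < e" and \<mu>: "\<mu> \<in> time_changes m"
    and b: "\<And>t. t \<in> {0..m} \<Longrightarrow> \<bar>\<mu> t - t\<bar> \<le> e \<and> \<bar>x t - y (\<mu> t)\<bar> \<le> e"
    by (auto simp: time_change_bounds_def)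
  let ?\<nu> = "inv_into {0..m} \<mu>"
  have bij: "bij_betw \<mu> {0..m} {0..m}"
    using \<mu> by (simp add: time_changes_def)
  have "\<bar>?\<nu> t - t\<bar> \<le> e \<and> \<bar>y t - x (?\<nu> t)\<bar> \<le> e" if t: "t \<in> {0..m}" for t
  proof -
    have "?\<nu> t \<in> {0..m}"
      using bij_betw_inv_into[OF bij] t by (rule bij_betw_apply)
    moreover have "\<mu> (?\<nu> t) = t"
      using bij t by (rule bij_betw_inv_into_right)
    ultimately show ?thesis
      using b[of "?\<nu> t"] by (simp add: abs_minus_commute)
  qed
  with e time_change_inv_into[OF \<mu>] show "e \<in> time_change_bounds m y x"
    unfolding time_change_bounds_def by blast
qed

lemma time_change_bounds_trans:
  assumes "e \<in> time_change_bounds m x y" "f \<in> time_change_bounds m y z"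
  shows "e + f \<in> time_change_bounds m x z"
proof -
  obtain \<mu> where e: "0 < e" and \<mu>: "\<mu> \<in> time_changes m"
    and b: "\<And>t. t \<in> {0..m} \<Longrightarrow> \<bar>\<mu> t - t\<bar> \<le> e \<and> \<bar>x t - y (\<mu> t)\<bar> \<le> e"
    using assms(1) by (auto simp: time_change_bounds_def)
  obtain \<nu> where f: "0 < f" and \<nu>: "\<nu> \<in> time_changes m"
    and c: "\<And>t. t \<in> {0..m} \<Longrightarrow> \<bar>\<nu> t - t\<bar> \<le> f \<and> \<bar>y t - z (\<nu> t)\<bar> \<le> f"
    using assms(2) by (auto simp: time_change_bounds_def)
  have bij: "bij_betw \<mu> {0..m} {0..m}" "bij_betw \<nu> {0..m} {0..m}"
    and mono: "strict_mono_on {0..m} \<mu>" "strict_mono_on {0..m} \<nu>"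
    using \<mu> \<nu> by (auto simp: time_changes_def)
  have mem: "\<mu> t \<in> {0..m}" if "t \<in> {0..m}" for t
    using bij(1) that by (rule bij_betw_apply)
  have "strict_mono_on {0..m} (\<nu> \<circ> \<mu>)"
    using mono mem by (auto simp: strict_mono_on_def)
  then have "\<nu> \<circ> \<mu> \<in> time_changes m"
    using bij_betw_trans[OF bij] by (simp add: time_changes_def)
  moreover have "\<bar>(\<nu> \<circ> \<mu>) t - t\<bar> \<le> e + f \<and> \<bar>x t - z ((\<nu> \<circ> \<mu>) t)\<bar> \<le> e + f"
    if t: "t \<in> {0..m}" for t
    using b[OF t] c[OF mem[OF t]] unfolding comp_def by linarith
  ultimately show ?thesis
    using e f unfolding time_change_bounds_def by fastforce
qed

lemma skorokhod_dist_on_bdd: "bdd_below (insert 1 (time_change_bounds m x y))"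
  by (rule bdd_belowI[of _ 0]) (auto simp: time_change_bounds_def)

lemma skorokhod_dist_on_nonneg: "0 \<le> skorokhod_dist_on m x y"
  unfolding skorokhod_dist_on_def
  by (rule cInf_greatest) (auto simp: time_change_bounds_def)

lemma skorokhod_dist_on_le_1: "skorokhod_dist_on m x y \<le> 1"
  unfolding skorokhod_dist_on_def by (rule cInf_lower[OF _ skorokhod_dist_on_bdd]) simp

lemma skorokhod_dist_on_commute: "skorokhod_dist_on m x y = skorokhod_dist_on m y x"
  using time_change_bounds_sym[of m x y] time_change_bounds_sym[of m y x]
  unfolding skorokhod_dist_on_def by (simp add: subset_antisym)

lemma skorokhod_dist_on_triangle:
  "skorokhod_dist_on m x z \<le> skorokhod_dist_on m x y + skorokhod_dist_on m y z"
proof (rule field_le_epsilon)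
  fix h :: real assume h: "0 < h"
  obtain e where e: "e \<in> insert 1 (time_change_bounds m x y)" "e < skorokhod_dist_on m x y + h/2"
    using cInf_lessD[of "insert 1 (time_change_bounds m x y)" "skorokhod_dist_on m x y + h/2"] h
    unfolding skorokhod_dist_on_def by auto
  obtain f where f: "f \<in> insert 1 (time_change_bounds m y z)" "f < skorokhod_dist_on m y z + h/2"
    using cInf_lessD[of "insert 1 (time_change_bounds m y z)" "skorokhod_dist_on m y z + h/2"] h
    unfolding skorokhod_dist_on_def by auto
  have pos: "0 < e" "0 < f"
    using e f by (auto simp: time_change_bounds_def)
  have "skorokhod_dist_on m x z \<le> e + f"
  proof (cases "e = 1 \<or> f = 1")
    case True
    then show ?thesis
      using pos skorokhod_dist_on_le_1[of m x z] by linarith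
  next
    case False
    then have "e + f \<in> time_change_bounds m x z"
      using e f by (auto intro: time_change_bounds_trans)
    then show ?thesis
      unfolding skorokhod_dist_on_def by (intro cInf_lower[OF _ skorokhod_dist_on_bdd]) simp
  qed
  with e f show "skorokhod_dist_on m x z \<le> skorokhod_dist_on m x y + skorokhod_dist_on m y z + h"
    by simp
qed

lemma skorokhod_dist_on_refl: "skorokhod_dist_on m x x = 0"
proof (rule antisym[OF field_le_epsilon skorokhod_dist_on_nonneg])
  fix h :: real assume h: "0 < h"
  have "id \<in> time_changes m"
    by (auto simp: time_changes_def strict_mono_on_def)
  then have "h \<in> time_change_bounds m x x"
    using h by (auto simp: time_change_bounds_def intro!: bexI[of _ id])
  then show "skorokhod_dist_on m x x \<le> 0 + h"
    unfolding skorokhod_dist_on_def using skorokhod_dist_on_bdd by (simp add: cInf_lower)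
qed

lemma skorokhod_dist_summable:
  "summable (\<lambda>k. (1/2) ^ Suc k * skorokhod_dist_on (m k) (x k) (y k))"
proof (rule summable_comparison_test)
  show "summable (\<lambda>k. (1/2::real) ^ Suc k)"
    using summable_geometric[of "1/2::real"] by (subst summable_Suc_iff) simp
  show "\<exists>N. \<forall>n\<ge>N. norm ((1/2) ^ Suc n * skorokhod_dist_on (m n) (x n) (y n)) \<le> (1/2) ^ Suc n"
    by (intro exI[of _ 0] allI impI)
       (simp add: abs_mult skorokhod_dist_on_nonneg skorokhod_dist_on_le_1)
qed

lemma skorokhod_dist_eq_0D:
  assumes x: "x \<in> skorokhod_space" and y: "y \<in> skorokhod_space" and d: "skorokhod_dist x y = 0"
  shows "x = y"
proof (rule ext)
  fix t :: real
  show "x t = y t"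
  proof (cases "0 \<le> t")
    case False
    then show ?thesis
      using x y by (simp add: skorokhod_space_def extensional_def)
  next
    case t: True
    show ?thesis
    proof (rule ccontr)
      assume "x t \<noteq> y t"
      define g where "g = \<bar>x t - y t\<bar> / 4"
      have g: "0 < g"
        using \<open>x t \<noteq> y t\<close> by (simp add: g_def)
      have "\<forall>\<^sub>F s in at_right t. dist (x s) (x t) < g" "\<forall>\<^sub>F s in at_right t. dist (y s) (y t) < g"
        using x y t g by (auto simp: skorokhod_space_def intro!: tendstoD)
      then have "\<forall>\<^sub>F s in at_right t. dist (x s) (x t) < g \<and> dist (y s) (y t) < g"
        by (rule eventually_conj)
      then obtain b where b: "t < b"
        and near: "\<And>s. t < s \<Longrightarrow> s < b \<Longrightarrow> dist (x s) (x t) < g \<and> dist (y s) (y t) < g"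
        by (auto simp: eventually_at_right[OF less_add_one[of t]])
      define h where "h = min 1 (b - t)"
      have h: "0 < h" "h \<le> 1" "t + h \<le> b"
        using b by (auto simp: h_def)
      define k where "k = nat \<lceil>t\<rceil> + 1"
      define m where "m = real (Suc k)"
      have m: "t + 2 \<le> m"
        unfolding m_def k_def using t by linarith
      have zero: "skorokhod_dist_on m (taper m x) (taper m y) = 0"
      proof -
        let ?f = "\<lambda>k. (1/2::real) ^ Suc k *
            skorokhod_dist_on (real (Suc k)) (taper (real (Suc k)) x) (taper (real (Suc k)) y)"
        have "summable ?f"
          by (rule skorokhod_dist_summable)
        moreover have "0 \<le> ?f k" for k
          by (simp add: skorokhod_dist_on_nonneg)
        ultimately have "\<forall>k. ?f k = 0"
          using d suminf_eq_zero_iff[of ?f] unfolding skorokhod_dist_def by blast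
        then show ?thesis
          unfolding m_def by (auto dest: spec[of _ k])
      qed
      define c where "c = min (1/2) (min (h/4) g)"
      have c: "0 < c" "c < 1" "c \<le> h/4" "c \<le> g"
        using h g by (auto simp: c_def)
      obtain e where "e \<in> insert 1 (time_change_bounds m (taper m x) (taper m y))" "e < c"
        using zero c cInf_lessD[of "insert 1 (time_change_bounds m (taper m x) (taper m y))" c]
        unfolding skorokhod_dist_on_def by auto
      then have e: "e < c" and "e \<in> time_change_bounds m (taper m x) (taper m y)"
        using c by auto
      then obtain \<mu> where \<mu>: "\<forall>s\<in>{0..m}. \<bar>\<mu> s - s\<bar> \<le> e \<and> \<bar>taper m x s - taper m y (\<mu> s)\<bar> \<le> e"
        unfolding time_change_bounds_def by blast
      define s where "s = t + h/2"
      have s: "s \<in> {0..m}" "t < s" "s < b" "s \<le> m - 1"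
        using t h m by (auto simp: s_def)
      have \<mu>s: "t < \<mu> s" "\<mu> s < b" "\<mu> s \<le> m - 1"
        using bspec[OF \<mu> s(1)] e c h m unfolding s_def by linarith+
      have "\<bar>x s - y (\<mu> s)\<bar> \<le> e"
        using bspec[OF \<mu> s(1)] s(4) \<mu>s(3) by (simp add: taper_def)
      moreover have "\<bar>x s - x t\<bar> < g" "\<bar>y (\<mu> s) - y t\<bar> < g"
        using near[of s] near[of "\<mu> s"] s \<mu>s by (auto simp: dist_real_def)
      ultimately have "\<bar>x t - y t\<bar> < 3 * g"
        using e c by linarith
      then show False
        using g by (simp add: g_def)
    qed
  qed
qed

lemma Metric_space_skorokhod: "Metric_space skorokhod_space skorokhod_dist"
proof
  fix x y z :: "real \<Rightarrow> real"
  show "0 \<le> skorokhod_dist x y"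
    unfolding skorokhod_dist_def
    by (intro suminf_nonneg skorokhod_dist_summable) (simp add: skorokhod_dist_on_nonneg)
  show "skorokhod_dist x y = skorokhod_dist y x"
    unfolding skorokhod_dist_def by (simp add: skorokhod_dist_on_commute)
  show "skorokhod_dist x y = 0 \<longleftrightarrow> x = y" if "x \<in> skorokhod_space" "y \<in> skorokhod_space"
    using skorokhod_dist_eq_0D[OF that] by (auto simp: skorokhod_dist_def skorokhod_dist_on_refl)
  show "skorokhod_dist x z \<le> skorokhod_dist x y + skorokhod_dist y z"
  proof -
    let ?f = "\<lambda>u v k. (1/2::real) ^ Suc k *
        skorokhod_dist_on (real (Suc k)) (taper (real (Suc k)) u) (taper (real (Suc k)) v)"
    have sum: "summable (?f u v)" for u v
      by (rule skorokhod_dist_summable)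
    have "?f x z k \<le> ?f x y k + ?f y z k" for k
      unfolding distrib_left[symmetric]
      by (intro mult_left_mono skorokhod_dist_on_triangle) simp
    then have "suminf (?f x z) \<le> (\<Sum>k. ?f x y k + ?f y z k)"
      by (intro suminf_le summable_add sum)
    then show ?thesis
      unfolding skorokhod_dist_def suminf_add[OF sum sum] .
  qed
qed

definition skorokhod_topology :: "(real \<Rightarrow> real) topology" where
  "skorokhod_topology = Metric_space.mtopology skorokhod_space skorokhod_dist"


section \<open>Convergence in distribution and the functional central limit theorem\<close>

definition borel_of :: "'a topology \<Rightarrow> 'a measure" where
  "borel_of T = sigma (topspace T) {U. openin T U}"

text \<open>
  Convergence in distribution of random elements \<open>Y n\<close> (on \<open>M\<close>) of a topological space \<open>T\<close> to a
  random element \<open>Z\<close>, which may live on another probability space \<open>N\<close>.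
\<close>

definition converges_in_distribution ::
    "'s topology \<Rightarrow> 'w measure \<Rightarrow> (nat \<Rightarrow> 'w \<Rightarrow> 's) \<Rightarrow> 'v measure \<Rightarrow> ('v \<Rightarrow> 's) \<Rightarrow> bool" where
  "converges_in_distribution T M Y N Z \<longleftrightarrow>
     (\<forall>n. Y n \<in> M \<rightarrow>\<^sub>M borel_of T) \<and> Z \<in> N \<rightarrow>\<^sub>M borel_of T \<and>
     (\<forall>f :: 's \<Rightarrow> real. continuous_map T euclideanreal f \<and> bounded (f ` topspace T) \<longrightarrow>
        (\<lambda>n. \<integral>\<omega>. f (Y n \<omega>) \<partial>M) \<longlonglongrightarrow> (\<integral>\<omega>. f (Z \<omega>) \<partial>N))"

definition standard_brownian_motion :: "'v measure \<Rightarrow> (real \<Rightarrow> 'v \<Rightarrow> real) \<Rightarrow> bool" where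
  "standard_brownian_motion N B \<longleftrightarrow>
     prob_space N \<and> (\<forall>t\<ge>0. B t \<in> borel_measurable N) \<and>
     (AE \<omega> in N. B 0 \<omega> = 0) \<and>
     (\<forall>\<omega>\<in>space N. continuous_on {0..} (\<lambda>t. B t \<omega>)) \<and>
     (\<forall>s t. 0 \<le> s \<and> s < t \<longrightarrow>
        distributed N lborel (\<lambda>\<omega>. B t \<omega> - B s \<omega>) (normal_density 0 (sqrt (t - s)))) \<and>
     (\<forall>k. \<forall>\<tau> :: nat \<Rightarrow> real. 0 \<le> \<tau> 0 \<and> (\<forall>i<k. \<tau> i < \<tau> (Suc i)) \<longrightarrow>
        prob_space.indep_vars N (\<lambda>_. borel) (\<lambda>i \<omega>. B (\<tau> (Suc i)) \<omega> - B (\<tau> i) \<omega>) {..<k})"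

text \<open>The path vanishes where \<open>\<lfloor>n t\<rfloor> = 0\<close> because of the leading factor.\<close>

definition fclt_path :: "(nat \<Rightarrow> 'w \<Rightarrow> real) \<Rightarrow> real \<Rightarrow> nat \<Rightarrow> 'w \<Rightarrow> real \<Rightarrow> real" where
  "fclt_path est c n \<omega> =
     (\<lambda>t\<in>{0..}. of_int \<lfloor>real n * t\<rfloor> / sqrt (real n) * (est (nat \<lfloor>real n * t\<rfloor>) \<omega> - c))"

definition fclt ::
    "'w measure \<Rightarrow> (nat \<Rightarrow> 'w \<Rightarrow> real) \<Rightarrow> real \<Rightarrow> real \<Rightarrow> 'v measure \<Rightarrow> (real \<Rightarrow> 'v \<Rightarrow> real) \<Rightarrow> bool"
  where
  "fclt M est c s N B \<longleftrightarrow>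
     converges_in_distribution skorokhod_topology M (fclt_path est c) N (\<lambda>\<omega>. \<lambda>t\<in>{0..}. s * B t \<omega>)"


section \<open>Estimators, confidence intervals and the stopping rule\<close>

definition computed_from_first ::
    "'w measure \<Rightarrow> 'a measure \<Rightarrow> (nat \<Rightarrow> 'w \<Rightarrow> 'a) \<Rightarrow> nat \<Rightarrow> ('w \<Rightarrow> real) \<Rightarrow> bool" where
  "computed_from_first M E X n est \<longleftrightarrow>
     (\<exists>h\<in>borel_measurable (PiM {..<n} (\<lambda>_. E)).
        \<forall>\<omega>\<in>space M. est \<omega> = h (\<lambda>i\<in>{..<n}. X i \<omega>))"

definition conf_interval ::
    "real \<Rightarrow> (nat \<Rightarrow> 'w \<Rightarrow> real) \<Rightarrow> (nat \<Rightarrow> 'w \<Rightarrow> real) \<Rightarrow> nat \<Rightarrow> 'w \<Rightarrow> real set" where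
  "conf_interval z est sd n \<omega> =
     {est n \<omega> - z * sd n \<omega> / sqrt (real n) <..< est n \<omega> + z * sd n \<omega> / sqrt (real n)}"

definition T3 ::
    "real \<Rightarrow> (nat \<Rightarrow> 'w \<Rightarrow> real) \<Rightarrow> (nat \<Rightarrow> 'w \<Rightarrow> real) \<Rightarrow> (nat \<Rightarrow> real) \<Rightarrow> real \<Rightarrow> 'w \<Rightarrow> enat" where
  "T3 z sd psd p \<epsilon> \<omega> =
     Inf (enat ` {n. 1 \<le> n \<and> 2 * z * sd n \<omega> / sqrt (real n) + p n \<le> \<epsilon> * psd n \<omega>})"

end

theory Submission
  imports Defs "HOL-Real_Asymp.Real_Asymp"
begin

text \<open>
  Put \<open>c = 2 * z * \<sigma> / lambda\<close>. For almost every outcome the stopping rule forces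
  \<open>\<epsilon> * sqrt (T3 \<epsilon>)\<close> to converge to \<open>c\<close> as \<open>\<epsilon>\<close> tends to \<open>0\<close>: the index tends to infinity because
  \<open>p\<close> is positive, the estimators may then be replaced by their limits, and \<open>p\<close> is negligible
  against \<open>n powr (- 1 / 2)\<close> (\<open>rule_met_tendsto_infinity\<close>, \<open>first_index_asymptotics\<close>). Hence \<open>T3 \<epsilon>\<close>
  divided by the deterministic \<open>n \<approx> (c / \<epsilon>)\<^sup>2\<close> tends to \<open>1\<close>.

  In terms of the \<open>n\<close>-th process of the functional central limit theorem, \<open>\<theta>\<close> is covered exactly when
  the value at the random time \<open>T3 \<epsilon> / n\<close> has absolute value below a random threshold that tends to
  \<open>z * \<sigma>\<close> (\<open>conf_interval_iff_fclt_path\<close>). Since the limit process \<open>\<sigma> * B\<close> has continuous paths, the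
  random time may be replaced by \<open>1\<close>, and the limiting coverage is the probability that
  \<open>\<bar>\<sigma> * B 1\<bar> \<le> z * \<sigma>\<close>, which is \<open>1 - \<delta>\<close>.

  The replacement of the random time is the probabilistic core, \<open>portmanteau_nearby_times\<close>. It bounds
  the limit superior of the probability that a path comes close to a closed set \<open>K\<close> at some time near
  \<open>\<tau>\<close> by the probability that the limit lies in \<open>K\<close> at time \<open>\<tau>\<close>. The proof tests the weak convergence
  against continuous bumps around the set of all paths with this property, and uses that a continuous
  path outside \<open>K\<close> at time \<open>\<tau>\<close> keeps a positive Skorokhod distance from that set
  once "close" and "near" are strict enough (\<open>near_paths_separated\<close>). This argument takes the place of tightness estimates. Applied to coverage
  and to noncoverage, it gives matching upper and lower bounds.
\<close>

section \<open>Continuous bumps around a set in a metric space\<close>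

text \<open>
  The distance from \<open>x\<close> to \<open>A\<close> is truncated at \<open>1\<close>, so that it is also meaningful for empty \<open>A\<close>.
\<close>

definition bump :: "('s \<Rightarrow> 's \<Rightarrow> real) \<Rightarrow> 's set \<Rightarrow> real \<Rightarrow> 's \<Rightarrow> real" where
  "bump d A r x = max 0 (1 - Inf (insert 1 (d x ` A)) / r)"

context Metric_space
begin

lemma trunc_setdist_bdd_below: "bdd_below (insert 1 (d x ` A))"
  by (rule bdd_belowI[of _ 0]) auto

lemma trunc_setdist_le_triangle:
  assumes "A \<subseteq> M" "x \<in> M" "y \<in> M"
  shows "Inf (insert 1 (d x ` A)) \<le> d x y + Inf (insert 1 (d y ` A))"
proof -
  have "Inf (insert 1 (d x ` A)) - d x y \<le> Inf (insert 1 (d y ` A))"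
  proof (rule cInf_greatest)
    fix u assume "u \<in> insert 1 (d y ` A)"
    then consider "u = 1" | a where "a \<in> A" "u = d y a" by auto
    then show "Inf (insert 1 (d x ` A)) - d x y \<le> u"
    proof cases
      case 1
      have "Inf (insert 1 (d x ` A)) \<le> 1"
        by (rule cInf_lower[OF _ trunc_setdist_bdd_below]) simp
      with 1 nonneg[of x y] show ?thesis by linarith
    next
      case 2
      have "Inf (insert 1 (d x ` A)) \<le> d x a"
        using 2 by (intro cInf_lower[OF _ trunc_setdist_bdd_below]) simp
      moreover have "d x a \<le> d x y + d y a"
        using assms 2 by (intro triangle) auto
      ultimately show ?thesis using 2 by linarith
    qed
  qed simp
  then show ?thesis by linarith
qed

text \<open>
  Through these functions weak convergence gives information about events that are neither open
  nor closed: a bump dominates the indicator of \<open>A\<close> and is continuous whatever \<open>A\<close> is.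
\<close>

lemma continuous_map_bump:
  assumes "A \<subseteq> M"
  shows "continuous_map mtopology euclideanreal (bump d A r)"
proof -
  let ?h = "\<lambda>x. Inf (insert 1 (d x ` A))"
  have "continuous_map mtopology Met_TC.mtopology ?h"
    unfolding Met_TC.continuous_map_to_metric
  proof (intro ballI allI impI)
    fix x and e :: real assume x: "x \<in> topspace mtopology" and e: "0 < e"
    have "?h y \<in> Met_TC.mball (?h x) e" if "y \<in> mball x e" for y
    proof -
      have "y \<in> M" "d x y < e" "x \<in> M" using that by auto
      then have "\<bar>?h x - ?h y\<bar> < e"
        using trunc_setdist_le_triangle[OF assms, of x y]
          trunc_setdist_le_triangle[OF assms, of y x] commute[of x y] by linarith
      then show ?thesis by (simp add: dist_real_def)
    qed
    then show "\<exists>U. openin mtopology U \<and> x \<in> U \<and> (\<forall>y\<in>U. ?h y \<in> Met_TC.mball (?h x) e)"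
      using x e by (intro exI[of _ "mball x e"]) auto
  qed
  then have "continuous_map mtopology euclideanreal ?h" by simp
  then show ?thesis
    unfolding bump_def[abs_def] divide_inverse
    by (intro continuous_map_real_max continuous_map_diff continuous_map_real_mult) auto
qed

lemma bump_eq_1:
  assumes "x \<in> A" "A \<subseteq> M"
  shows "bump d A r x = 1"
proof -
  have "Inf (insert 1 (d x ` A)) = 0"
  proof (rule antisym)
    have "d x x = 0" using assms by auto
    then show "Inf (insert 1 (d x ` A)) \<le> 0"
      using assms by (intro cInf_lower[OF _ trunc_setdist_bdd_below]) (auto simp: image_iff)
    show "0 \<le> Inf (insert 1 (d x ` A))"
      by (rule cInf_greatest) auto
  qed
  then show ?thesis by (simp add: bump_def)
qed

lemma bump_le_1:
  assumes "0 < r"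
  shows "bump d A r x \<le> 1"
proof -
  have "0 \<le> Inf (insert 1 (d x ` A))"
    by (rule cInf_greatest) auto
  then show ?thesis using assms by (simp add: bump_def)
qed

end

lemma bump_nonneg: "0 \<le> bump d A r x"
  by (simp add: bump_def)

lemma bump_eq_0:
  assumes "0 < r" "r \<le> 1" "\<And>a. a \<in> A \<Longrightarrow> r \<le> d x a"
  shows "bump d A r x = 0"
proof -
  have "r \<le> Inf (insert 1 (d x ` A))"
    using assms by (intro cInf_greatest) auto
  then show ?thesis using assms by (simp add: bump_def)
qed

lemma borel_measurable_borel_of:
  fixes f :: "'s \<Rightarrow> real"
  assumes f: "continuous_map T euclideanreal f"
  shows "f \<in> borel_measurable (borel_of T)"
proof -
  have sub: "{U. openin T U} \<subseteq> Pow (topspace T)"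
    by (auto dest: openin_subset)
  show ?thesis
    unfolding borel_def
  proof (rule measurable_measure_of)
    fix S :: "real set" assume "S \<in> {S. open S}"
    then have "openin T {x \<in> topspace T. f x \<in> S}"
      using f by (auto simp: continuous_map_def)
    then have "{x \<in> topspace T. f x \<in> S} \<in> sets (borel_of T)"
      unfolding borel_of_def by (simp add: sets_measure_of[OF sub] sigma_sets.Basic)
    moreover have "f -` S \<inter> space (borel_of T) = {x \<in> topspace T. f x \<in> S}"
      unfolding borel_of_def by (auto simp: space_measure_of[OF sub])
    ultimately show "f -` S \<inter> space (borel_of T) \<in> sets (borel_of T)" by simp
  qed auto
qed

lemma space_borel_of: "space (borel_of T) = topspace T"
  unfolding borel_of_def by (rule space_measure_of) (auto dest: openin_subset)


section \<open>Evaluating Skorokhod paths near a fixed time\<close>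

text \<open>
  Tolerance is needed in both coordinates: in time, because evaluation at a fixed time is not
  continuous for the Skorokhod metric and because the time of interest is random; in value, because
  the half-width of the confidence interval is random.
\<close>

definition near_paths :: "real \<Rightarrow> real set \<Rightarrow> real \<Rightarrow> (real \<Rightarrow> real) set" where
  "near_paths \<tau> K r =
     {x \<in> skorokhod_space. \<exists>t\<ge>0. \<exists>v\<in>K. \<bar>t - \<tau>\<bar> \<le> r \<and> \<bar>x t - v\<bar> \<le> r}"

lemma skorokhod_dist_on_le_dist:
  "(1/2) ^ Suc k * skorokhod_dist_on (real (Suc k)) (taper (real (Suc k)) x) (taper (real (Suc k)) y)
     \<le> skorokhod_dist x y"
proof -
  let ?f = "\<lambda>k. (1/2::real) ^ Suc k *
            skorokhod_dist_on (real (Suc k)) (taper (real (Suc k)) x) (taper (real (Suc k)) y)"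
  have "sum ?f {k} \<le> suminf ?f"
    by (rule sum_le_suminf[OF skorokhod_dist_summable]) (auto simp: skorokhod_dist_on_nonneg)
  then show ?thesis unfolding skorokhod_dist_def by simp
qed

text \<open>
  Evaluation at \<open>\<tau>\<close> is continuous at continuous paths, uniformly over nearby times. A path \<open>x\<close> close
  to \<open>y\<close> in the Skorokhod metric agrees with \<open>y\<close> up to a small error after a small shift of time, and
  a continuous \<open>y\<close> changes little under such a shift. So if \<open>y \<tau>\<close> keeps away from \<open>K\<close>, then \<open>x\<close>
  cannot come close to \<open>K\<close> at a time close to \<open>\<tau>\<close>.
\<close>

lemma near_paths_separated:
  assumes cont: "continuous_on {0..} y" and \<tau>: "0 \<le> \<tau>" and K: "closed K" and yK: "y \<tau> \<notin> K"
  obtains \<rho> where "0 < \<rho>" "\<And>x r. x \<in> near_paths \<tau> K r \<Longrightarrow> r \<le> \<rho> \<Longrightarrow> \<rho> \<le> skorokhod_dist y x"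
proof -
  obtain g0 where g0: "0 < g0" "ball (y \<tau>) g0 \<inter> K = {}"
  proof -
    have "open (- K)" "y \<tau> \<in> - K" using K yK by auto
    then obtain g0 where "0 < g0" "ball (y \<tau>) g0 \<subseteq> - K"
      using open_contains_ball_eq by blast
    then show thesis by (intro that[of g0]) auto
  qed
  define g where "g = g0 / 3"
  have g: "0 < g" using g0 by (simp add: g_def)
  obtain \<eta> where \<eta>: "0 < \<eta>" "\<And>s. 0 \<le> s \<Longrightarrow> \<bar>s - \<tau>\<bar> < \<eta> \<Longrightarrow> \<bar>y s - y \<tau>\<bar> < g"
  proof -
    have "\<exists>\<eta>>0. \<forall>s\<in>{0..}. dist s \<tau> < \<eta> \<longrightarrow> dist (y s) (y \<tau>) < g"
      using cont \<tau> g unfolding continuous_on_iff by auto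
    then obtain \<eta> where "0 < \<eta>" "\<forall>s\<in>{0..}. dist s \<tau> < \<eta> \<longrightarrow> dist (y s) (y \<tau>) < g"
      by blast
    then show thesis by (intro that[of \<eta>]) (auto simp: dist_real_def)
  qed
  \<comment> \<open>A horizon so large that the taper equals \<open>1\<close> at all times that matter.\<close>
  define k where "k = nat \<lceil>\<tau>\<rceil> + 2"
  define m where "m = real (Suc k)"
  have m: "\<tau> + 3 \<le> m"
    unfolding m_def k_def using \<tau> by linarith
  define c where "c = min (1/2) (min (\<eta>/3) g)"
  have c: "0 < c" "c < 1" "c \<le> \<eta>/3" "c \<le> g"
    using \<eta> g by (auto simp: c_def)
  \<comment> \<open>The factor is the weight of the horizon \<open>m\<close> in the Skorokhod metric.\<close>
  define \<rho> where "\<rho> = (1/2)^Suc k * c"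
  have \<rho>: "0 < \<rho>" "\<rho> \<le> c"
    using c by (auto simp: \<rho>_def intro!: mult_left_le_one_le power_le_one simp del: power_Suc)
  show thesis
  proof (rule that[OF \<rho>(1)])
    fix x r assume x: "x \<in> near_paths \<tau> K r" and r: "r \<le> \<rho>"
    obtain t v where t: "0 \<le> t" "v \<in> K" "\<bar>t - \<tau>\<bar> \<le> r" "\<bar>x t - v\<bar> \<le> r"
      using x by (auto simp: near_paths_def)
    show "\<rho> \<le> skorokhod_dist y x"
    proof (rule ccontr)
      assume "\<not> \<rho> \<le> skorokhod_dist y x"
      then have "(1/2) ^ Suc k * skorokhod_dist_on m (taper m y) (taper m x) < (1/2)^Suc k * c"
        using skorokhod_dist_on_le_dist[of k y x] unfolding m_def \<rho>_def by linarith
      then have "skorokhod_dist_on m (taper m y) (taper m x) < c"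
        by (rule mult_left_less_imp_less) simp
      then have "skorokhod_dist_on m (taper m x) (taper m y) < c"
        by (simp only: skorokhod_dist_on_commute)
      then obtain e where "e \<in> insert 1 (time_change_bounds m (taper m x) (taper m y))" "e < c"
        using cInf_lessD[of "insert 1 (time_change_bounds m (taper m x) (taper m y))" c]
        unfolding skorokhod_dist_on_def by auto
      then have e: "e < c" and "e \<in> time_change_bounds m (taper m x) (taper m y)"
        using c by auto
      then obtain \<mu> where \<mu>: "\<mu> \<in> time_changes m"
          "\<forall>s\<in>{0..m}. \<bar>\<mu> s - s\<bar> \<le> e \<and> \<bar>taper m x s - taper m y (\<mu> s)\<bar> \<le> e"
        unfolding time_change_bounds_def by blast
      have tm: "t \<in> {0..m}" "t \<le> m - 2"
        using t m c r \<rho> by auto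
      have "\<mu> t \<in> {0..m}"
        using \<mu>(1) tm(1) by (auto simp: time_changes_def dest: bij_betw_apply)
      moreover have \<mu>t: "\<bar>\<mu> t - t\<bar> \<le> e" "\<bar>taper m x t - taper m y (\<mu> t)\<bar> \<le> e"
        using \<mu>(2) tm(1) by auto
      ultimately have "\<bar>y (\<mu> t) - y \<tau>\<bar> < g"
        using e c r \<rho> t \<eta>(1) by (intro \<eta>(2)) auto
      moreover have "\<mu> t \<le> m - 1" using \<mu>t tm e c by linarith
      then have "\<bar>x t - y (\<mu> t)\<bar> \<le> e"
        using \<mu>t(2) tm by (simp add: taper_def)
      ultimately have "\<bar>y \<tau> - v\<bar> < g0"
        using e c r \<rho> t unfolding g_def by linarith
      then have "v \<in> ball (y \<tau>) g0" by (simp add: dist_real_def)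
      with g0 t show False by auto
    qed
  qed
qed


section \<open>Weak convergence at random times\<close>

lemma (in prob_space) prob_tendsto_0_if_AE_eventually_notin:
  assumes D: "\<And>k. D k \<in> events" and ae: "AE \<omega> in M. \<forall>\<^sub>F k in sequentially. \<omega> \<notin> D k"
  shows "(\<lambda>k. prob (D k)) \<longlonglongrightarrow> 0"
proof -
  have "(\<lambda>k. \<integral>\<omega>. indicator (D k) \<omega> \<partial>M) \<longlonglongrightarrow> (\<integral>\<omega>. (0::real) \<partial>M)"
  proof (rule integral_dominated_convergence[where w = "\<lambda>_. 1"])
    show "AE \<omega> in M. (\<lambda>k. indicator (D k) \<omega> :: real) \<longlonglongrightarrow> 0"
      using ae
    proof eventually_elim
      case (elim \<omega>)
      then show ?case
        by (intro tendsto_eventually) (auto elim!: eventually_mono)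
    qed
  qed (use D in \<open>auto simp: indicator_def\<close>)
  then show ?thesis using D by simp
qed

text \<open>
  The closed-set half of the portmanteau theorem, at times that are random but close to \<open>\<tau>\<close>. The
  events \<open>F k\<close> need only imply that the path comes close to \<open>K\<close> near time \<open>\<tau>\<close>; hence a random time
  and a random perturbation of \<open>K\<close> are both covered.

  The reason is that up to an event of vanishing probability \<open>F k\<close> lies in the event that the path
  belongs to \<open>near_paths \<tau> K r\<close>, whose indicator is bounded by a continuous bump. Weak convergence
  replaces the path by \<open>Z\<close> in the expectation of the bump. As \<open>r\<close> tends to \<open>0\<close> the bump vanishes at
  every continuous path that avoids \<open>K\<close> at time \<open>\<tau>\<close>, by separation.
\<close>

lemma portmanteau_nearby_times:
  fixes Y :: "nat \<Rightarrow> 'w \<Rightarrow> real \<Rightarrow> real" and Z :: "'v \<Rightarrow> real \<Rightarrow> real"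
  assumes M: "prob_space M" and N: "prob_space N"
    and conv: "converges_in_distribution skorokhod_topology M Y N Z"
    and cont: "\<And>\<omega>. \<omega> \<in> space N \<Longrightarrow> continuous_on {0..} (Z \<omega>)"
    and Z\<tau>: "(\<lambda>\<omega>. Z \<omega> \<tau>) \<in> borel_measurable N"
    and \<tau>: "0 \<le> \<tau>" and K: "closed K"
    and n: "filterlim n at_top sequentially"
    and F: "\<And>k. F k \<in> sets M"
    and near: "AE \<omega> in M. \<forall>r>0. \<forall>\<^sub>F k in sequentially. \<omega> \<in> F k \<longrightarrow>
        (\<exists>t\<ge>0. \<exists>v\<in>K. \<bar>t - \<tau>\<bar> \<le> r \<and> \<bar>Y (n k) \<omega> t - v\<bar> \<le> r)"
    and e: "0 < e"
  shows "\<forall>\<^sub>F k in sequentially. measure M (F k) \<le> measure N {\<omega> \<in> space N. Z \<omega> \<tau> \<in> K} + e"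
proof -
  interpret M: prob_space M by fact
  interpret N: prob_space N by fact
  interpret S: Metric_space skorokhod_space skorokhod_dist by (rule Metric_space_skorokhod)
  define r where "r i = 1 / real (Suc i)" for i
  have r: "0 < r i" "r i \<le> 1" for i by (auto simp: r_def)
  define f where "f i = bump skorokhod_dist (near_paths \<tau> K (r i)) (r i)" for i
  have sub: "near_paths \<tau> K (r i) \<subseteq> skorokhod_space" for i
    by (auto simp: near_paths_def)
  have f01: "0 \<le> f i x" "f i x \<le> 1" for i x
    unfolding f_def using r by (auto intro: bump_nonneg S.bump_le_1)
  have f_abs: "\<bar>f i x\<bar> \<le> 1" for i x
    using f01[of i x] by auto
  have max01: "\<bar>max (f i x) (indicator K v)\<bar> \<le> 1" for i x v
    using f01[of i x] by (auto simp: indicator_def)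
  have fcont: "continuous_map skorokhod_topology euclideanreal (f i)" for i
    unfolding f_def skorokhod_topology_def by (rule S.continuous_map_bump[OF sub])
  note fmeas [measurable] = borel_measurable_borel_of[OF fcont]
  have Y [measurable]: "Y k \<in> M \<rightarrow>\<^sub>M borel_of skorokhod_topology" for k
    using conv by (auto simp: converges_in_distribution_def)
  have Z [measurable]: "Z \<in> N \<rightarrow>\<^sub>M borel_of skorokhod_topology"
    using conv by (auto simp: converges_in_distribution_def)
  have Yspace: "Y k \<omega> \<in> skorokhod_space" if "\<omega> \<in> space M" for k \<omega>
    using measurable_space[OF Y that] by (simp add: space_borel_of skorokhod_topology_def)
  have KB [measurable]: "K \<in> sets borel" using K by (rule borel_closed)
  note Z\<tau> [measurable] F [measurable]
  let ?p = "measure N {\<omega> \<in> space N. Z \<omega> \<tau> \<in> K}"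
  \<comment> \<open>The maximum with the indicator turns the one-sided pointwise bound on the limit into a limit,
    as dominated convergence requires.\<close>
  have fZ: "(\<lambda>i. max (f i (Z \<omega>)) (indicator K (Z \<omega> \<tau>))) \<longlonglongrightarrow> (indicator K (Z \<omega> \<tau>) :: real)"
    if \<omega>: "\<omega> \<in> space N" for \<omega>
  proof (cases "Z \<omega> \<tau> \<in> K")
    case True
    then show ?thesis using f01 by (simp add: max_absorb2)
  next
    case False
    obtain \<rho> where \<rho>: "0 < \<rho>"
        "\<And>x s. x \<in> near_paths \<tau> K s \<Longrightarrow> s \<le> \<rho> \<Longrightarrow> \<rho> \<le> skorokhod_dist (Z \<omega>) x"
      using near_paths_separated[OF cont[OF \<omega>] \<tau> K False] by blast
    have "r \<longlonglongrightarrow> 0"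
      unfolding r_def[abs_def] using LIMSEQ_inverse_real_of_nat by (simp add: inverse_eq_divide)
    then have "\<forall>\<^sub>F i in sequentially. r i < \<rho>"
      using \<rho>(1) by (rule order_tendstoD)
    then have "\<forall>\<^sub>F i in sequentially. f i (Z \<omega>) = 0"
    proof eventually_elim
      case (elim i)
      show ?case
        unfolding f_def
      proof (rule bump_eq_0[OF r])
        fix a assume "a \<in> near_paths \<tau> K (r i)"
        with \<rho>(2)[of a "r i"] elim show "r i \<le> skorokhod_dist (Z \<omega>) a" by linarith
      qed
    qed
    then show ?thesis
      using False by (intro tendsto_eventually) (auto elim!: eventually_mono)
  qed
  have "(\<lambda>i. \<integral>\<omega>. max (f i (Z \<omega>)) (indicator K (Z \<omega> \<tau>)) \<partial>N) \<longlonglongrightarrow> (\<integral>\<omega>. indicator K (Z \<omega> \<tau>) \<partial>N)"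
    by (rule integral_dominated_convergence[where w = "\<lambda>_. 1"])
       (use fZ max01 in auto)
  also have "(\<integral>\<omega>. indicator K (Z \<omega> \<tau>) \<partial>N) = (\<integral>\<omega>. indicator {\<omega> \<in> space N. Z \<omega> \<tau> \<in> K} \<omega> \<partial>N)"
    by (rule Bochner_Integration.integral_cong) (auto simp: indicator_def)
  also have "\<dots> = ?p" by simp
  finally have "\<forall>\<^sub>F i in sequentially.
      (\<integral>\<omega>. max (f i (Z \<omega>)) (indicator K (Z \<omega> \<tau>)) \<partial>N) < ?p + e / 3"
    using e by (intro order_tendstoD) auto
  then obtain i where i: "(\<integral>\<omega>. max (f i (Z \<omega>)) (indicator K (Z \<omega> \<tau>)) \<partial>N) < ?p + e / 3"
    by (auto simp: eventually_sequentially)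
  have "(\<integral>\<omega>. f i (Z \<omega>) \<partial>N) \<le> (\<integral>\<omega>. max (f i (Z \<omega>)) (indicator K (Z \<omega> \<tau>)) \<partial>N)"
    by (intro integral_mono N.integrable_const_bound[where B = 1])
       (use max01 f01 in auto)
  with i have fi: "(\<integral>\<omega>. f i (Z \<omega>) \<partial>N) < ?p + e / 3" by linarith
  have "bounded (f i ` topspace skorokhod_topology)"
    using f01 by (auto simp: bounded_iff intro!: exI[of _ 1])
  then have "(\<lambda>k. \<integral>\<omega>. f i (Y k \<omega>) \<partial>M) \<longlonglongrightarrow> (\<integral>\<omega>. f i (Z \<omega>) \<partial>N)"
    using conv fcont unfolding converges_in_distribution_def by blast
  from filterlim_compose[OF this n]
  have ev1: "\<forall>\<^sub>F k in sequentially. (\<integral>\<omega>. f i (Y (n k) \<omega>) \<partial>M) < ?p + e / 3"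
    using fi by (rule order_tendstoD)
  \<comment> \<open>Membership of the path in \<open>near_paths\<close> need not be a measurable event, so the exceptional part
    of \<open>F k\<close> is described through the bump.\<close>
  define D where "D k = {\<omega> \<in> space M. \<omega> \<in> F k \<and> f i (Y (n k) \<omega>) \<noteq> 1}" for k
  have D [measurable]: "D k \<in> sets M" for k
    unfolding D_def by measurable
  have "AE \<omega> in M. \<forall>\<^sub>F k in sequentially. \<omega> \<notin> D k"
    using near AE_space
  proof eventually_elim
    case (elim \<omega>)
    from elim(1) r[of i] have "\<forall>\<^sub>F k in sequentially. \<omega> \<in> F k \<longrightarrow>
        (\<exists>t\<ge>0. \<exists>v\<in>K. \<bar>t - \<tau>\<bar> \<le> r i \<and> \<bar>Y (n k) \<omega> t - v\<bar> \<le> r i)" by blast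
    then show ?case
    proof eventually_elim
      case (elim k)
      then have "\<omega> \<in> F k \<Longrightarrow> Y (n k) \<omega> \<in> near_paths \<tau> K (r i)"
        using Yspace[OF \<open>\<omega> \<in> space M\<close>, of "n k"] by (auto simp: near_paths_def)
      then show ?case
        unfolding D_def f_def using S.bump_eq_1[OF _ sub] by auto
    qed
  qed
  from M.prob_tendsto_0_if_AE_eventually_notin[OF D this]
  have ev2: "\<forall>\<^sub>F k in sequentially. M.prob (D k) < e / 3"
    using e by (intro order_tendstoD) auto
  from ev1 ev2 show ?thesis
  proof eventually_elim
    case (elim k)
    have ind: "integrable M (indicator (F k) :: _ \<Rightarrow> real)" "integrable M (indicator (D k) :: _ \<Rightarrow> real)"
      by (auto intro!: integrable_real_indicator simp: M.emeasure_eq_measure)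
    have int: "integrable M (\<lambda>\<omega>. f i (Y (n k) \<omega>))"
      by (intro M.integrable_const_bound[where B = 1]) (simp_all add: f_abs)
    have "M.prob (F k) = (\<integral>\<omega>. indicator (F k) \<omega> \<partial>M)" by simp
    also have "\<dots> \<le> (\<integral>\<omega>. f i (Y (n k) \<omega>) + indicator (D k) \<omega> \<partial>M)"
    proof (rule integral_mono)
      fix \<omega> assume "\<omega> \<in> space M"
      then show "indicator (F k) \<omega> \<le> f i (Y (n k) \<omega>) + indicator (D k) \<omega>"
        using f01(1)[of i "Y (n k) \<omega>"] by (auto simp: indicator_def D_def)
    qed (use int ind in simp_all)
    also have "\<dots> = (\<integral>\<omega>. f i (Y (n k) \<omega>) \<partial>M) + M.prob (D k)"
      using int ind by simp
    finally show ?case using elim e by linarith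
  qed
qed

section \<open>The stopping index along a single path\<close>

text \<open>
  The stopping rule at index \<open>n\<close>, for the sequences of estimates \<open>s\<close> and \<open>l\<close> observed along one
  outcome; the stopping time is studied outcome by outcome.
\<close>

definition rule_met :: "real \<Rightarrow> (nat \<Rightarrow> real) \<Rightarrow> (nat \<Rightarrow> real) \<Rightarrow> (nat \<Rightarrow> real) \<Rightarrow> real \<Rightarrow> nat \<Rightarrow> bool" where
  "rule_met z s l p \<epsilon> n \<longleftrightarrow> 1 \<le> n \<and> 2 * z * s n / sqrt (real n) + p n \<le> \<epsilon> * l n"

lemma T3_conv_Least:
  "T3 z sd psd p \<epsilon> \<omega> =
     (if \<exists>n. rule_met z (\<lambda>n. sd n \<omega>) (\<lambda>n. psd n \<omega>) p \<epsilon> n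
      then enat (LEAST n. rule_met z (\<lambda>n. sd n \<omega>) (\<lambda>n. psd n \<omega>) p \<epsilon> n) else \<infinity>)"
proof -
  let ?P = "rule_met z (\<lambda>n. sd n \<omega>) (\<lambda>n. psd n \<omega>) p \<epsilon>"
  have T: "T3 z sd psd p \<epsilon> \<omega> = Inf (enat ` {n. ?P n})"
    unfolding T3_def rule_met_def ..
  show ?thesis
  proof (cases "\<exists>n. ?P n")
    case True
    have "Inf (enat ` {n. ?P n}) = enat (LEAST n. ?P n)"
    proof (rule antisym)
      show "Inf (enat ` {n. ?P n}) \<le> enat (LEAST n. ?P n)"
        using LeastI_ex[OF True] by (intro Inf_lower) auto
      show "enat (LEAST n. ?P n) \<le> Inf (enat ` {n. ?P n})"
        by (rule Inf_greatest) (auto intro: Least_le)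
    qed
    with True T show ?thesis by simp
  next
    case False
    then show ?thesis using T by (simp add: Inf_enat_def)
  qed
qed

lemma T3_eq_enat_iff:
  "T3 z sd psd p \<epsilon> \<omega> = enat n \<longleftrightarrow>
     rule_met z (\<lambda>n. sd n \<omega>) (\<lambda>n. psd n \<omega>) p \<epsilon> n \<and>
     (\<forall>m<n. \<not> rule_met z (\<lambda>n. sd n \<omega>) (\<lambda>n. psd n \<omega>) p \<epsilon> m)"
proof -
  let ?P = "rule_met z (\<lambda>n. sd n \<omega>) (\<lambda>n. psd n \<omega>) p \<epsilon>"
  have "(LEAST m. ?P m) = n \<longleftrightarrow> ?P n \<and> (\<forall>m<n. \<not> ?P m)" if "?P k" for k
    using that LeastI[of ?P k] not_less_Least[of _ ?P]
    by (metis Least_equality not_le)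
  then show ?thesis
    unfolding T3_conv_Least by auto
qed

text \<open>
  The left-hand side of the stopping rule tends to \<open>0\<close> and the right-hand side to \<open>\<epsilon> * L > 0\<close>, so
  the simulation terminates.
\<close>

lemma rule_met_eventually:
  assumes s: "s \<longlonglongrightarrow> \<sigma>" and l: "l \<longlonglongrightarrow> L" and L: "0 < L" and \<epsilon>: "0 < \<epsilon>"
    and p: "(\<lambda>n. sqrt (real n) * p n) \<longlonglongrightarrow> 0"
  shows "\<forall>\<^sub>F n in sequentially. rule_met z s l p \<epsilon> n"
proof -
  have inv: "(\<lambda>n. 1 / sqrt (real n)) \<longlonglongrightarrow> 0"
    by real_asymp
  have "(\<lambda>n. (2 * z * s n + sqrt (real n) * p n) * (1 / sqrt (real n)) - \<epsilon> * l n)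
      \<longlonglongrightarrow> (2 * z * \<sigma> + 0) * 0 - \<epsilon> * L"
    by (intro tendsto_intros s l p inv)
  moreover have "(2 * z * \<sigma> + 0) * 0 - \<epsilon> * L < 0" using L \<epsilon> by simp
  ultimately have "\<forall>\<^sub>F n in sequentially.
      (2 * z * s n + sqrt (real n) * p n) * (1 / sqrt (real n)) - \<epsilon> * l n < 0"
    by (rule order_tendstoD)
  with eventually_ge_at_top[of 1] show ?thesis
  proof eventually_elim
    case (elim n)
    then have "sqrt (real n) > 0" by simp
    with elim show ?case by (simp add: rule_met_def field_simps)
  qed
qed

text \<open>
  Positivity of \<open>p\<close> is what prevents early stopping: even if \<open>s j = 0\<close> by accident, the index \<open>j\<close>
  fails the rule once \<open>\<epsilon> * l j < p j\<close>.
\<close>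

lemma rule_met_tendsto_infinity:
  fixes N :: "nat \<Rightarrow> nat"
  assumes z: "0 \<le> z" and s: "\<And>n. 1 \<le> n \<Longrightarrow> 0 \<le> s n" and p: "\<And>n. 1 \<le> n \<Longrightarrow> 0 < p n"
    and \<epsilon>: "\<epsilon> \<longlonglongrightarrow> 0" and N: "\<And>k. rule_met z s l p (\<epsilon> k) (N k)"
  shows "filterlim N at_top sequentially"
  unfolding filterlim_at_top
proof
  fix m
  have "\<forall>\<^sub>F k in sequentially. \<forall>j\<in>{1..m}. \<epsilon> k * l j < p j"
  proof (rule eventually_ball_finite)
    show "\<forall>j\<in>{1..m}. \<forall>\<^sub>F k in sequentially. \<epsilon> k * l j < p j"
    proof
      fix j assume "j \<in> {1..m}"
      then have "0 < p j" using p by simp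
      then show "\<forall>\<^sub>F k in sequentially. \<epsilon> k * l j < p j"
        using tendsto_mult_left_zero[OF \<epsilon>, of "l j"] by (intro order_tendstoD)
    qed
  qed simp
  then show "\<forall>\<^sub>F k in sequentially. m \<le> N k"
  proof eventually_elim
    case (elim k)
    show ?case
    proof (rule ccontr)
      assume "\<not> m \<le> N k"
      moreover have Nk: "1 \<le> N k" "2 * z * s (N k) / sqrt (real (N k)) + p (N k) \<le> \<epsilon> k * l (N k)"
        using N[of k] by (auto simp: rule_met_def)
      moreover have "0 \<le> 2 * z * s (N k) / sqrt (real (N k))"
        using z s[OF Nk(1)] by simp
      ultimately show False using elim by force
    qed
  qed
qed

text \<open>
  Multiplied by the square root of the index, the rule compares \<open>\<epsilon> * sqrt n\<close> with a quantity that
  converges to \<open>2 * z * \<sigma> / L\<close>, because \<open>p\<close> is of smaller order. The rule holds at the first index and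
  fails at its predecessor, and the square roots of the two differ by at most \<open>1\<close>. So, when
  the limit is positive, the index is asymptotic to \<open>(2 * z * \<sigma> / (L * \<epsilon>))\<^sup>2\<close>.
\<close>

lemma first_index_asymptotics:
  fixes N :: "nat \<Rightarrow> nat"
  assumes s: "s \<longlonglongrightarrow> \<sigma>" and l: "l \<longlonglongrightarrow> L" and L: "0 < L"
    and p: "(\<lambda>n. sqrt (real n) * p n) \<longlonglongrightarrow> 0"
    and \<epsilon>: "\<epsilon> \<longlonglongrightarrow> 0" "\<And>k. 0 < \<epsilon> k"
    and N: "\<And>k. rule_met z s l p (\<epsilon> k) (N k)"
    and first: "\<And>k m. m < N k \<Longrightarrow> \<not> rule_met z s l p (\<epsilon> k) m"
    and N_inf: "filterlim N at_top sequentially"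
  shows "(\<lambda>k. \<epsilon> k * sqrt (real (N k))) \<longlonglongrightarrow> 2 * z * \<sigma> / L"
proof -
  define a where "a n = (2 * z * s n + sqrt (real n) * p n) / l n" for n
  have "a \<longlonglongrightarrow> (2 * z * \<sigma> + 0) / L"
    unfolding a_def[abs_def] using L by (intro tendsto_intros s l p) auto
  then have a: "a \<longlonglongrightarrow> 2 * z * \<sigma> / L" by simp
  have scale: "sqrt (real n) * (2 * z * s n / sqrt (real n) + p n) = a n * l n"
    if "1 \<le> n" "0 < l n" for n
    using that by (simp add: a_def field_simps)
  have lpos: "\<forall>\<^sub>F n in sequentially. 0 < l n"
    using l L by (rule order_tendstoD)
  have N1_inf: "filterlim (\<lambda>k. N k - 1) at_top sequentially"
    using filterlim_minus_const_nat_at_top[of 1] N_inf by (rule filterlim_compose)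
  show ?thesis
  proof (rule tendsto_sandwich)
    show "(\<lambda>k. a (N k)) \<longlonglongrightarrow> 2 * z * \<sigma> / L"
      using a N_inf by (rule filterlim_compose)
    have "(\<lambda>k. a (N k - 1) + \<epsilon> k) \<longlonglongrightarrow> 2 * z * \<sigma> / L + 0"
      by (intro tendsto_add filterlim_compose[OF a N1_inf] \<epsilon>)
    then show "(\<lambda>k. a (N k - 1) + \<epsilon> k) \<longlonglongrightarrow> 2 * z * \<sigma> / L" by simp
    show "\<forall>\<^sub>F k in sequentially. a (N k) \<le> \<epsilon> k * sqrt (real (N k))"
      using eventually_compose_filterlim[OF lpos N_inf]
    proof eventually_elim
      case (elim k)
      have Nk: "1 \<le> N k" "2 * z * s (N k) / sqrt (real (N k)) + p (N k) \<le> \<epsilon> k * l (N k)"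
        using N[of k] by (auto simp: rule_met_def)
      have "a (N k) * l (N k) \<le> sqrt (real (N k)) * (\<epsilon> k * l (N k))"
        unfolding scale[OF Nk(1) elim, symmetric] by (rule mult_left_mono[OF Nk(2)]) simp
      then have "a (N k) * l (N k) \<le> (\<epsilon> k * sqrt (real (N k))) * l (N k)"
        by (simp add: mult_ac)
      then show ?case using elim by (rule mult_right_le_imp_le)
    qed
    show "\<forall>\<^sub>F k in sequentially. \<epsilon> k * sqrt (real (N k)) \<le> a (N k - 1) + \<epsilon> k"
      using eventually_compose_filterlim[OF lpos N1_inf]
        eventually_compose_filterlim[OF eventually_ge_at_top[of 2] N_inf]
    proof eventually_elim
      case (elim k)
      define m where "m = N k - 1"
      have m: "1 \<le> m" "m < N k" "real (N k) = real m + 1" "0 < l m"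
        using elim by (auto simp: m_def)
      have "\<epsilon> k * l m \<le> 2 * z * s m / sqrt (real m) + p m"
        using first[OF m(2)] m(1) by (simp add: rule_met_def)
      then have "sqrt (real m) * (\<epsilon> k * l m) \<le> a m * l m"
        unfolding scale[OF m(1,4), symmetric] by (rule mult_left_mono) simp
      then have "(\<epsilon> k * sqrt (real m)) * l m \<le> a m * l m"
        by (simp add: mult_ac)
      then have "\<epsilon> k * sqrt (real m) \<le> a m" using m(4) by (rule mult_right_le_imp_le)
      moreover have "sqrt (real (N k)) \<le> sqrt (real m) + 1"
        unfolding m(3) using sqrt_add_le_add_sqrt[of "real m" 1] by simp
      then have "\<epsilon> k * sqrt (real (N k)) \<le> \<epsilon> k * (sqrt (real m) + 1)"
        using \<epsilon>(2)[of k] by (intro mult_left_mono) auto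
      ultimately show ?case by (simp add: m_def algebra_simps)
    qed
  qed
qed

lemma sqrt_mult_tendsto_0_if_smallo:
  fixes p :: "nat \<Rightarrow> real"
  assumes "p \<in> o(\<lambda>n. real n powr (- 1 / 2))"
  shows "(\<lambda>n. sqrt (real n) * p n) \<longlonglongrightarrow> 0"
proof -
  have "(\<lambda>n. p n / real n powr (- 1 / 2)) \<longlonglongrightarrow> 0"
    using assms by (rule smalloD_tendsto)
  then show ?thesis
  proof (rule Lim_transform_eventually)
    show "\<forall>\<^sub>F n in sequentially. p n / real n powr (- 1 / 2) = sqrt (real n) * p n"
      using eventually_ge_at_top[of 1]
      by eventually_elim (simp add: powr_minus powr_half_sqrt field_simps)
  qed
qed

lemma ceiling_scale_asymptotics:
  fixes c :: real and \<epsilon> :: "nat \<Rightarrow> real"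
  assumes c: "0 < c" and \<epsilon>: "\<epsilon> \<longlonglongrightarrow> 0" "\<And>k. 0 < \<epsilon> k"
  defines "n \<equiv> \<lambda>k. nat \<lceil>(c / \<epsilon> k)\<^sup>2\<rceil>"
  shows "filterlim n at_top sequentially" "1 \<le> n k"
    "(\<lambda>k. \<epsilon> k * sqrt (real (n k))) \<longlonglongrightarrow> c"
proof -
  have pos: "0 < (c / \<epsilon> k)\<^sup>2" for k
    using c \<epsilon>(2)[of k] by simp
  have low: "(c / \<epsilon> k)\<^sup>2 \<le> real (n k)" for k
    unfolding n_def by (rule real_nat_ceiling_ge)
  have up: "real (n k) \<le> (c / \<epsilon> k)\<^sup>2 + 1" for k
    unfolding n_def using pos[of k] by linarith
  show "1 \<le> n k"
    using pos[of k] low[of k] by (cases "n k") auto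
  have sq: "(\<epsilon> k)\<^sup>2 * (c / \<epsilon> k)\<^sup>2 = c\<^sup>2" for k
    using \<epsilon>(2)[of k] by (simp add: power_divide)
  have "(\<lambda>k. (\<epsilon> k)\<^sup>2 * real (n k)) \<longlonglongrightarrow> c\<^sup>2"
  proof (rule tendsto_sandwich)
    show "\<forall>\<^sub>F k in sequentially. c\<^sup>2 \<le> (\<epsilon> k)\<^sup>2 * real (n k)"
      using mult_left_mono[OF low, of "(\<epsilon> k)\<^sup>2" k for k] sq by (intro always_eventually) simp
    show "\<forall>\<^sub>F k in sequentially. (\<epsilon> k)\<^sup>2 * real (n k) \<le> c\<^sup>2 + (\<epsilon> k)\<^sup>2"
      using mult_left_mono[OF up, of "(\<epsilon> k)\<^sup>2" k for k] sq
      by (intro always_eventually) (simp add: distrib_left)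
    have "(\<lambda>k. c\<^sup>2 + (\<epsilon> k)\<^sup>2) \<longlonglongrightarrow> c\<^sup>2 + 0\<^sup>2"
      by (intro tendsto_intros \<epsilon>)
    then show "(\<lambda>k. c\<^sup>2 + (\<epsilon> k)\<^sup>2) \<longlonglongrightarrow> c\<^sup>2" by simp
  qed simp
  from tendsto_real_sqrt[OF this] show "(\<lambda>k. \<epsilon> k * sqrt (real (n k))) \<longlonglongrightarrow> c"
    using c \<epsilon>(2) by (simp add: real_sqrt_mult abs_of_pos)
  have "filterlim \<epsilon> (at_right 0) sequentially"
    using \<epsilon> by (intro filterlim_atI tendsto_imp_filterlim_at_right) auto
  then have "filterlim (\<lambda>k. inverse (\<epsilon> k)) at_top sequentially"
    by (rule filterlim_compose[OF filterlim_inverse_at_top_right])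
  then have "filterlim (\<lambda>k. c * inverse (\<epsilon> k)) at_top sequentially"
    using c by (intro filterlim_tendsto_pos_mult_at_top[OF tendsto_const])
  then have "filterlim (\<lambda>k. (c / \<epsilon> k)\<^sup>2) at_top sequentially"
    by (intro filterlim_pow_at_top) (auto simp: divide_inverse)
  then have "filterlim (\<lambda>k. real (n k)) at_top sequentially"
    by (rule filterlim_at_top_mono) (simp add: low)
  then show "filterlim n at_top sequentially"
    by (simp add: filterlim_sequentially_iff_filterlim_real)
qed

section \<open>Tails of the limit law\<close>

text \<open>
  Since \<open>\<delta> / 2 < 1 / 2\<close>, the quantile \<open>z\<close> lies to the right of the centre of symmetry, so the two
  tails beyond \<open>z\<close> and \<open>- z\<close> are disjoint and have total mass \<open>\<delta>\<close>.
\<close>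

lemma (in prob_space) std_normal_tails:
  assumes X: "distributed M lborel X std_normal_density"
    and z: "measure std_normal_distribution {z<..} = \<delta> / 2" and \<delta>: "\<delta> < 1"
  shows "0 < z" "prob {\<omega> \<in> space M. z \<le> \<bar>X \<omega>\<bar>} = \<delta>" "prob {\<omega> \<in> space M. \<bar>X \<omega>\<bar> \<le> z} = 1 - \<delta>"
proof -
  have law: "prob {\<omega> \<in> space M. X' \<omega> \<in> A} = measure std_normal_distribution A"
    if "distributed M lborel X' std_normal_density" "A \<in> sets borel" for X' and A :: "real set"
  proof -
    have "measure (distr M lborel X') A = prob (X' -` A \<inter> space M)"
      using that by (intro measure_distr) (auto dest: distributed_measurable)
    then show ?thesis
      using distributed_distr_eq_density[OF that(1)] by (simp add: vimage_def Int_def conj_commute)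
  qed
  have X' : "distributed M lborel (\<lambda>\<omega>. - X \<omega>) std_normal_density"
    using normal_density_affine[OF X, of "- 1" 0] by simp
  have Xm [measurable]: "X \<in> borel_measurable M"
    using distributed_measurable[OF X] by simp
  have atom: "prob {\<omega> \<in> space M. X \<omega> = c} = 0" for c
  proof -
    have "emeasure std_normal_distribution {c} =
        (\<integral>\<^sup>+x. ennreal (std_normal_density x) * indicator {c} x \<partial>lborel)"
      by (rule emeasure_density) auto
    also have "\<dots> = 0" by (rule nn_integral_null_set) (auto simp: null_sets_def)
    finally show ?thesis
      using law[OF X, of "{c}"] by (simp add: measure_def)
  qed
  have right: "prob {\<omega> \<in> space M. z < X \<omega>} = \<delta> / 2"
    using law[OF X, of "{z<..}"] z by simp
  have left: "prob {\<omega> \<in> space M. X \<omega> < - z} = \<delta> / 2"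
    using law[OF X', of "{z<..}"] z by (simp add: less_minus_iff)
  show zpos: "0 < z"
  proof (rule ccontr)
    assume "\<not> 0 < z"
    have "1 = prob (space M)" by (simp add: prob_space)
    also have "\<dots> \<le> prob ({\<omega> \<in> space M. z < X \<omega>} \<union> {\<omega> \<in> space M. X \<omega> < - z} \<union> {\<omega> \<in> space M. X \<omega> = 0})"
      using \<open>\<not> 0 < z\<close> by (intro finite_measure_mono) auto
    also have "\<dots> \<le> prob {\<omega> \<in> space M. z < X \<omega>} + prob {\<omega> \<in> space M. X \<omega> < - z}
        + prob {\<omega> \<in> space M. X \<omega> = 0}"
      by (intro order_trans[OF measure_Un_le] add_right_mono measure_Un_le) auto
    finally show False using right left atom[of 0] \<delta> by simp
  qed
  have outer: "prob {\<omega> \<in> space M. z < \<bar>X \<omega>\<bar>} = \<delta>"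
  proof -
    have "{\<omega> \<in> space M. z < \<bar>X \<omega>\<bar>} = {\<omega> \<in> space M. z < X \<omega>} \<union> {\<omega> \<in> space M. X \<omega> < - z}"
      by (auto simp: abs_if)
    moreover have "prob ({\<omega> \<in> space M. z < X \<omega>} \<union> {\<omega> \<in> space M. X \<omega> < - z}) = \<delta> / 2 + \<delta> / 2"
      using zpos right left by (subst finite_measure_Union) auto
    ultimately show ?thesis by simp
  qed
  have "{\<omega> \<in> space M. \<bar>X \<omega>\<bar> \<le> z} = space M - {\<omega> \<in> space M. z < \<bar>X \<omega>\<bar>}" by auto
  then show "prob {\<omega> \<in> space M. \<bar>X \<omega>\<bar> \<le> z} = 1 - \<delta>"
    using outer by (simp add: prob_compl)
  have "prob {\<omega> \<in> space M. z \<le> \<bar>X \<omega>\<bar>} = prob {\<omega> \<in> space M. z < \<bar>X \<omega>\<bar>}"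
  proof (rule finite_measure_eq_AE)
    have "AE \<omega> in M. X \<omega> \<noteq> c" for c
      using atom[of c] by (subst AE_iff_measurable[OF _ refl]) (auto simp: emeasure_eq_measure)
    from this[of z] this[of "- z"]
    show "AE \<omega> in M. (\<omega> \<in> {\<omega> \<in> space M. z \<le> \<bar>X \<omega>\<bar>}) = (\<omega> \<in> {\<omega> \<in> space M. z < \<bar>X \<omega>\<bar>})"
      by eventually_elim (auto simp: abs_if split: if_splits)
  qed auto
  with outer show "prob {\<omega> \<in> space M. z \<le> \<bar>X \<omega>\<bar>} = \<delta>" by simp
qed

lemma brownian_motion_std_normal_at_1:
  assumes "standard_brownian_motion N B"
  shows "distributed N lborel (\<lambda>\<omega>. B 1 \<omega> - B 0 \<omega>) std_normal_density"
proof -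
  have "distributed N lborel (\<lambda>\<omega>. B 1 \<omega> - B 0 \<omega>) (normal_density 0 (sqrt (1 - 0)))"
    using assms unfolding standard_brownian_motion_def by (elim conjE allE[of _ 0] allE[of _ 1]) auto
  then show ?thesis by simp
qed

section \<open>Measurability, and coverage as an event about paths\<close>

lemma computed_from_first_measurable:
  assumes X: "\<And>n. X n \<in> M \<rightarrow>\<^sub>M E" and est: "computed_from_first M E X n est"
  shows "est \<in> borel_measurable M"
proof -
  obtain h where h [measurable]: "h \<in> borel_measurable (PiM {..<n} (\<lambda>_. E))"
    and eq: "\<And>\<omega>. \<omega> \<in> space M \<Longrightarrow> est \<omega> = h (\<lambda>i\<in>{..<n}. X i \<omega>)"
    using est unfolding computed_from_first_def by blast
  note X [measurable]
  have "(\<lambda>\<omega>. h (\<lambda>i\<in>{..<n}. X i \<omega>)) \<in> borel_measurable M"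
    by measurable
  then show ?thesis using eq by (subst measurable_cong) auto
qed

lemma T3_measurable:
  assumes "\<And>n. 1 \<le> n \<Longrightarrow> sd n \<in> borel_measurable M" "\<And>n. 1 \<le> n \<Longrightarrow> psd n \<in> borel_measurable M"
  shows "T3 z sd psd p \<epsilon> \<in> M \<rightarrow>\<^sub>M count_space UNIV"
proof -
  have [measurable]: "Measurable.pred M (\<lambda>\<omega>. rule_met z (\<lambda>n. sd n \<omega>) (\<lambda>n. psd n \<omega>) p \<epsilon> n)" for n
  proof (cases "1 \<le> n")
    case True
    note assms(1)[OF True, measurable] assms(2)[OF True, measurable]
    show ?thesis unfolding rule_met_def by measurable
  qed (simp add: rule_met_def)
  show ?thesis
    unfolding T3_conv_Least[abs_def] by measurable
qed

text \<open>
  At \<open>n = 0\<close> nothing is known about the estimators, but there division by \<open>0\<close> makes the interval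
  empty. This matters since \<open>the_enat\<close> is unspecified at \<open>\<infinity>\<close>.
\<close>

lemma conf_interval_measurable:
  assumes "\<And>n. 1 \<le> n \<Longrightarrow> est n \<in> borel_measurable M" "\<And>n. 1 \<le> n \<Longrightarrow> sd n \<in> borel_measurable M"
  shows "Measurable.pred M (\<lambda>\<omega>. c \<in> conf_interval z est sd n \<omega>)"
proof (cases "1 \<le> n")
  case True
  note assms(1)[OF True, measurable] assms(2)[OF True, measurable]
  show ?thesis unfolding conf_interval_def greaterThanLessThan_iff by measurable
next
  case False
  then have "n = 0" by simp
  then show ?thesis by (simp add: conf_interval_def)
qed

lemma fclt_path_ratio:
  assumes "1 \<le> n"
  shows "fclt_path est c n \<omega> (real m / real n) = real m / sqrt (real n) * (est m \<omega> - c)"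
proof -
  have "real n * (real m / real n) = real m" using assms by simp
  then show ?thesis by (simp add: fclt_path_def)
qed

text \<open>
  Coverage at a random index \<open>m\<close> is an event about the path with deterministic index \<open>n\<close>, evaluated
  at the random time \<open>m / n\<close>; the threshold absorbs the change of normalization.
\<close>

lemma conf_interval_iff_fclt_path:
  assumes m: "1 \<le> m" and n: "1 \<le> n"
  shows "c \<in> conf_interval z est sd m \<omega> \<longleftrightarrow>
    \<bar>fclt_path est c n \<omega> (real m / real n)\<bar> < z * sd m \<omega> * sqrt (real m / real n)"
proof -
  have pos: "0 < real m / sqrt (real n)" "0 < sqrt (real m)" "0 < sqrt (real n)" using m n by auto
  have sq: "real m = sqrt (real m) * sqrt (real m)" by simp
  have "c \<in> conf_interval z est sd m \<omega> \<longleftrightarrow> \<bar>est m \<omega> - c\<bar> < z * sd m \<omega> / sqrt (real m)"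
    by (auto simp: conf_interval_def)
  also have "\<dots> \<longleftrightarrow> real m / sqrt (real n) * \<bar>est m \<omega> - c\<bar> <
      real m / sqrt (real n) * (z * sd m \<omega> / sqrt (real m))"
    by (simp only: mult_less_cancel_left_pos[OF pos(1)])
  also have "real m / sqrt (real n) * (z * sd m \<omega> / sqrt (real m)) =
      z * sd m \<omega> * sqrt (real m / real n)"
    using pos(2,3) unfolding real_sqrt_divide by (subst sq) (simp add: field_simps del: real_sqrt_mult_self)
  also have "real m / sqrt (real n) * \<bar>est m \<omega> - c\<bar> =
      \<bar>fclt_path est c n \<omega> (real m / real n)\<bar>"
    unfolding fclt_path_ratio[OF n] by (simp add: abs_mult)
  finally show ?thesis .
qed

lemma near_band_inside:
  fixes y :: real
  assumes "\<bar>y\<bar> < V" "\<bar>V - w\<bar> \<le> r" "0 \<le> w"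
  shows "\<exists>v\<in>{v. \<bar>v\<bar> \<le> w}. \<bar>y - v\<bar> \<le> r"
  using assms by (intro bexI[of _ "max (- w) (min w y)"]) auto

lemma near_band_outside:
  fixes y :: real
  assumes "V \<le> \<bar>y\<bar>" "\<bar>V - w\<bar> \<le> r" "0 \<le> w"
  shows "\<exists>v\<in>{v. w \<le> \<bar>v\<bar>}. \<bar>y - v\<bar> \<le> r"
  using assms
  by (intro bexI[of _ "if w \<le> \<bar>y\<bar> then y else if 0 \<le> y then w else - w"]) auto

section \<open>Asymptotic coverage\<close>

text \<open>
  The events of coverage and of noncoverage both satisfy the hypothesis of the portmanteau bound
  with \<open>\<tau> = 1\<close>, for the closed sets \<open>\<bar>v\<bar> \<le> z * \<sigma>\<close> and \<open>\<bar>v\<bar> \<ge> z * \<sigma>\<close>. These sets overlap only in two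
  points, which carry no mass under the normal limit, so the two upper bounds \<open>1 - \<delta>\<close> and \<open>\<delta>\<close>
  add up to \<open>1\<close> and hence determine the limit.
\<close>

lemma coverage_along_sequence:
  fixes M :: "'w measure" and N :: "'v measure"
  assumes M: "prob_space M"
    and est: "\<And>n. 1 \<le> n \<Longrightarrow> est n \<in> borel_measurable M"
    and sd: "\<And>n. 1 \<le> n \<Longrightarrow> sd n \<in> borel_measurable M"
    and psd: "\<And>n. 1 \<le> n \<Longrightarrow> psd n \<in> borel_measurable M"
    and sd_nonneg: "\<And>n \<omega>. 1 \<le> n \<Longrightarrow> \<omega> \<in> space M \<Longrightarrow> 0 \<le> sd n \<omega>"
    and \<delta>: "\<delta> < 1" and z: "measure std_normal_distribution {z<..} = \<delta> / 2"
    and p_pos: "\<And>n. 1 \<le> n \<Longrightarrow> 0 < p n"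
    and p: "(\<lambda>n. sqrt (real n) * p n) \<longlonglongrightarrow> 0"
    and \<sigma>: "0 < \<sigma>" and brownian: "standard_brownian_motion N B" and fclt: "fclt M est \<theta> \<sigma> N B"
    and L: "0 < L"
    and psd_lim: "AE \<omega> in M. (\<lambda>n. psd n \<omega>) \<longlonglongrightarrow> L"
    and sd_lim: "AE \<omega> in M. (\<lambda>n. sd n \<omega>) \<longlonglongrightarrow> \<sigma>"
    and \<epsilon>: "\<epsilon> \<longlonglongrightarrow> 0" "\<And>k. 0 < \<epsilon> k"
  shows "(\<lambda>k. measure M {\<omega> \<in> space M.
      \<theta> \<in> conf_interval z est sd (the_enat (T3 z sd psd p (\<epsilon> k) \<omega>)) \<omega>}) \<longlonglongrightarrow> 1 - \<delta>"
proof -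
  interpret M: prob_space M by fact
  interpret N: prob_space N using brownian by (simp add: standard_brownian_motion_def)
  define Z where "Z \<omega> = (\<lambda>t\<in>{0..}. \<sigma> * B t \<omega>)" for \<omega>
  have [measurable]: "B 1 \<in> borel_measurable N" "B 0 \<in> borel_measurable N"
    using brownian by (simp_all add: standard_brownian_motion_def)
  have Z1: "Z \<omega> 1 = \<sigma> * B 1 \<omega>" for \<omega> by (simp add: Z_def)
  have conv: "converges_in_distribution skorokhod_topology M (fclt_path est \<theta>) N Z"
    using fclt by (simp add: fclt_def Z_def[abs_def])
  have Zcont: "continuous_on {0..} (Z \<omega>)" if "\<omega> \<in> space N" for \<omega>
  proof -
    have "continuous_on {0..} (\<lambda>t. \<sigma> * B t \<omega>)"
      using brownian that by (intro continuous_intros) (auto simp: standard_brownian_motion_def)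
    then show ?thesis
      by (subst continuous_on_cong[OF refl]) (auto simp: Z_def)
  qed
  note normal = N.std_normal_tails[OF brownian_motion_std_normal_at_1[OF brownian] z \<delta>]
  have B0_0: "AE \<omega> in N. B 0 \<omega> = 0"
    using brownian by (simp add: standard_brownian_motion_def)
  have Zin: "N.prob {\<omega> \<in> space N. Z \<omega> 1 \<in> {v. \<bar>v\<bar> \<le> z * \<sigma>}} = 1 - \<delta>"
  proof -
    have "N.prob {\<omega> \<in> space N. Z \<omega> 1 \<in> {v. \<bar>v\<bar> \<le> z * \<sigma>}} =
        N.prob {\<omega> \<in> space N. \<bar>B 1 \<omega> - B 0 \<omega>\<bar> \<le> z}"
    proof (rule N.finite_measure_eq_AE)
      show "AE \<omega> in N. (\<omega> \<in> {\<omega> \<in> space N. Z \<omega> 1 \<in> {v. \<bar>v\<bar> \<le> z * \<sigma>}}) =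
          (\<omega> \<in> {\<omega> \<in> space N. \<bar>B 1 \<omega> - B 0 \<omega>\<bar> \<le> z})"
        using B0_0 by eventually_elim (use \<sigma> in \<open>auto simp: Z1 abs_mult mult.commute\<close>)
    qed (auto simp: Z1)
    with normal(3) show ?thesis by simp
  qed
  have Zout: "N.prob {\<omega> \<in> space N. Z \<omega> 1 \<in> {v. z * \<sigma> \<le> \<bar>v\<bar>}} = \<delta>"
  proof -
    have "N.prob {\<omega> \<in> space N. Z \<omega> 1 \<in> {v. z * \<sigma> \<le> \<bar>v\<bar>}} =
        N.prob {\<omega> \<in> space N. z \<le> \<bar>B 1 \<omega> - B 0 \<omega>\<bar>}"
    proof (rule N.finite_measure_eq_AE)
      show "AE \<omega> in N. (\<omega> \<in> {\<omega> \<in> space N. Z \<omega> 1 \<in> {v. z * \<sigma> \<le> \<bar>v\<bar>}}) =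
          (\<omega> \<in> {\<omega> \<in> space N. z \<le> \<bar>B 1 \<omega> - B 0 \<omega>\<bar>})"
        using B0_0 by eventually_elim (use \<sigma> in \<open>auto simp: Z1 abs_mult mult.commute\<close>)
    qed (auto simp: Z1)
    with normal(2) show ?thesis by simp
  qed
  \<comment> \<open>The stopping index is asymptotic to \<open>(c / \<epsilon>)\<^sup>2\<close>; \<open>n k\<close> is a deterministic index of this size.\<close>
  define c where "c = 2 * z * \<sigma> / L"
  have c: "0 < c" using normal(1) \<sigma> L by (simp add: c_def)
  define n where "n k = nat \<lceil>(c / \<epsilon> k)\<^sup>2\<rceil>" for k
  note n = ceiling_scale_asymptotics[OF c \<epsilon>, folded n_def]
  define T where "T k \<omega> = the_enat (T3 z sd psd p (\<epsilon> k) \<omega>)" for k \<omega>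
  define V where "V k \<omega> = z * sd (T k \<omega>) \<omega> * sqrt (real (T k \<omega>) / real (n k))" for k \<omega>
  have pathwise: "AE \<omega> in M. \<forall>r>0. \<forall>\<^sub>F k in sequentially.
      1 \<le> T k \<omega> \<and> \<bar>real (T k \<omega>) / real (n k) - 1\<bar> \<le> r \<and> \<bar>V k \<omega> - z * \<sigma>\<bar> \<le> r"
    using psd_lim sd_lim AE_space
  proof eventually_elim
    case (elim \<omega>)
    let ?P = "rule_met z (\<lambda>n. sd n \<omega>) (\<lambda>n. psd n \<omega>) p"
    have "\<exists>n. ?P (\<epsilon> k) n" for k
      using rule_met_eventually[OF elim(2,1) L \<epsilon>(2)[of k] p, of z]
      by (auto simp: eventually_sequentially)
    then obtain N where N: "\<And>k. T3 z sd psd p (\<epsilon> k) \<omega> = enat (N k)"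
      unfolding T3_conv_Least by simp
    then have TN: "T k \<omega> = N k" for k by (simp add: T_def)
    from N have met: "?P (\<epsilon> k) (N k)" and first: "m < N k \<Longrightarrow> \<not> ?P (\<epsilon> k) m" for k m
      by (auto simp: T3_eq_enat_iff)
    have N1: "1 \<le> N k" for k using met[of k] by (simp add: rule_met_def)
    have inf: "filterlim N at_top sequentially"
      using normal(1) sd_nonneg elim(3) p_pos
      by (intro rule_met_tendsto_infinity[OF _ _ _ \<epsilon>(1) met]) auto
    have "(\<lambda>k. \<epsilon> k * sqrt (real (N k))) \<longlonglongrightarrow> c"
      unfolding c_def by (rule first_index_asymptotics[OF elim(2,1) L p \<epsilon> met first inf])
    then have "(\<lambda>k. (\<epsilon> k * sqrt (real (N k))) / (\<epsilon> k * sqrt (real (n k)))) \<longlonglongrightarrow> c / c"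
      using n(3) c by (intro tendsto_divide) auto
    moreover have "(\<epsilon> k * sqrt (real (N k))) / (\<epsilon> k * sqrt (real (n k))) = sqrt (real (N k) / real (n k))" for k
      using \<epsilon>(2)[of k] by (simp add: real_sqrt_divide)
    ultimately have ratio: "(\<lambda>k. sqrt (real (N k) / real (n k))) \<longlonglongrightarrow> 1"
      using c by simp
    from tendsto_power[OF this, of 2] have ratio2: "(\<lambda>k. real (N k) / real (n k)) \<longlonglongrightarrow> 1"
      by simp
    have "(\<lambda>k. z * sd (N k) \<omega> * sqrt (real (N k) / real (n k))) \<longlonglongrightarrow> z * \<sigma> * 1"
      by (intro tendsto_intros filterlim_compose[OF elim(2) inf] ratio)
    then have V: "(\<lambda>k. V k \<omega>) \<longlonglongrightarrow> z * \<sigma>" by (simp add: V_def TN)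
    show ?case
    proof (intro allI impI)
      fix r :: real assume r: "0 < r"
      from tendstoD[OF ratio2 r] tendstoD[OF V r]
      show "\<forall>\<^sub>F k in sequentially.
          1 \<le> T k \<omega> \<and> \<bar>real (T k \<omega>) / real (n k) - 1\<bar> \<le> r \<and> \<bar>V k \<omega> - z * \<sigma>\<bar> \<le> r"
        by eventually_elim (use N1 in \<open>auto simp: TN dist_real_def\<close>)
    qed
  qed
  define F where "F k = {\<omega> \<in> space M. \<theta> \<in> conf_interval z est sd (T k \<omega>) \<omega>}" for k
  have F: "F k \<in> sets M" for k
  proof -
    have "T k \<in> M \<rightarrow>\<^sub>M count_space UNIV"
      unfolding T_def[abs_def]
      by (rule measurable_compose[OF T3_measurable[OF sd psd]]) auto
    from measurable_compose_countable[OF conf_interval_measurable[OF est sd] this]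
    show ?thesis unfolding F_def by (rule measurable_sets_Collect) auto
  qed
  have cov: "\<omega> \<in> F k \<longleftrightarrow> \<bar>fclt_path est \<theta> (n k) \<omega> (real (T k \<omega>) / real (n k))\<bar> < V k \<omega>"
    if "\<omega> \<in> space M" "1 \<le> T k \<omega>" for \<omega> k
    using conf_interval_iff_fclt_path[OF that(2) n(2)] that(1) by (simp add: F_def V_def)
  have w: "0 \<le> z * \<sigma>" using normal(1) \<sigma> by simp
  have limsup_bound: "\<forall>\<^sub>F k in sequentially. M.prob (G k) \<le> N.prob {\<omega> \<in> space N. Z \<omega> 1 \<in> K} + e"
    if e: "0 < e" and K: "closed K" and G: "\<And>k. G k \<in> sets M"
      and near: "\<And>k \<omega> r. \<omega> \<in> G k \<Longrightarrow> \<omega> \<in> space M \<Longrightarrow> 1 \<le> T k \<omega> \<Longrightarrow> \<bar>V k \<omega> - z * \<sigma>\<bar> \<le> r \<Longrightarrow>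
        \<exists>v\<in>K. \<bar>fclt_path est \<theta> (n k) \<omega> (real (T k \<omega>) / real (n k)) - v\<bar> \<le> r"
    for G K e
  proof (rule portmanteau_nearby_times[OF M N.prob_space_axioms conv Zcont _ _ K n(1) G _ e])
    show "AE \<omega> in M. \<forall>r>0. \<forall>\<^sub>F k in sequentially. \<omega> \<in> G k \<longrightarrow>
        (\<exists>t\<ge>0. \<exists>v\<in>K. \<bar>t - 1\<bar> \<le> r \<and> \<bar>fclt_path est \<theta> (n k) \<omega> t - v\<bar> \<le> r)"
      using pathwise AE_space
    proof eventually_elim
      case (elim \<omega>)
      show ?case
      proof (intro allI impI)
        fix r :: real assume "0 < r"
        with elim(1) have "\<forall>\<^sub>F k in sequentially.
          1 \<le> T k \<omega> \<and> \<bar>real (T k \<omega>) / real (n k) - 1\<bar> \<le> r \<and> \<bar>V k \<omega> - z * \<sigma>\<bar> \<le> r" by blast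
        then show "\<forall>\<^sub>F k in sequentially. \<omega> \<in> G k \<longrightarrow>
            (\<exists>t\<ge>0. \<exists>v\<in>K. \<bar>t - 1\<bar> \<le> r \<and> \<bar>fclt_path est \<theta> (n k) \<omega> t - v\<bar> \<le> r)"
        proof eventually_elim
          case (elim k)
          show ?case
          proof (intro impI exI[of _ "real (T k \<omega>) / real (n k)"] conjI)
            assume "\<omega> \<in> G k"
            with near[OF _ \<open>\<omega> \<in> space M\<close>] elim show "\<exists>v\<in>K. \<bar>real (T k \<omega>) / real (n k) - 1\<bar> \<le> r \<and>
                \<bar>fclt_path est \<theta> (n k) \<omega> (real (T k \<omega>) / real (n k)) - v\<bar> \<le> r"
              by blast
          qed simp
        qed
      qed
    qed
  qed (simp_all add: Z1)
  have upper: "\<forall>\<^sub>F k in sequentially. M.prob (F k) \<le> 1 - \<delta> + e" if "0 < e" for e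
    unfolding Zin[symmetric]
  proof (rule limsup_bound[OF that _ F])
    fix k \<omega> r assume "\<omega> \<in> F k" "\<omega> \<in> space M" "1 \<le> T k \<omega>" "\<bar>V k \<omega> - z * \<sigma>\<bar> \<le> r"
    then show "\<exists>v\<in>{v. \<bar>v\<bar> \<le> z * \<sigma>}.
        \<bar>fclt_path est \<theta> (n k) \<omega> (real (T k \<omega>) / real (n k)) - v\<bar> \<le> r"
      using cov by (intro near_band_inside[OF _ _ w]) auto
  qed (intro closed_Collect_le continuous_intros)
  have lower: "\<forall>\<^sub>F k in sequentially. M.prob (space M - F k) \<le> \<delta> + e" if "0 < e" for e
    unfolding Zout[symmetric]
  proof (rule limsup_bound[OF that])
    fix k \<omega> r assume "\<omega> \<in> space M - F k" "\<omega> \<in> space M" "1 \<le> T k \<omega>" "\<bar>V k \<omega> - z * \<sigma>\<bar> \<le> r"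
    then show "\<exists>v\<in>{v. z * \<sigma> \<le> \<bar>v\<bar>}.
        \<bar>fclt_path est \<theta> (n k) \<omega> (real (T k \<omega>) / real (n k)) - v\<bar> \<le> r"
      using cov by (intro near_band_outside[OF _ _ w]) (auto simp: not_less)
  qed (use F in \<open>auto intro!: closed_Collect_le continuous_intros\<close>)
  have "(\<lambda>k. M.prob (F k)) \<longlonglongrightarrow> 1 - \<delta>"
  proof (rule tendstoI)
    fix e :: real assume "0 < e"
    then have "0 < e / 2" by simp
    from upper[OF this] lower[OF this]
    show "\<forall>\<^sub>F k in sequentially. dist (M.prob (F k)) (1 - \<delta>) < e"
      by eventually_elim (use F \<open>0 < e\<close> in \<open>auto simp: M.prob_compl dist_real_def abs_if\<close>)
  qed
  then show ?thesis by (simp add: F_def T_def)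
qed

theorem theorem1:
  fixes S :: "(real ^ 'd) set"
    and E :: "(real ^ 'd) measure"
    and P :: "real ^ 'd \<Rightarrow> (real ^ 'd) measure"
    and \<pi> :: "(real ^ 'd) measure"
    and M :: "'w measure"
    and X :: "nat \<Rightarrow> 'w \<Rightarrow> real ^ 'd"
    and theta_hat sigma_hat lambda_hat :: "nat \<Rightarrow> 'w \<Rightarrow> real"
    and \<theta> \<sigma> lambda \<delta> z :: real
    and p :: "nat \<Rightarrow> real"
    and N :: "'v measure"
    and B :: "real \<Rightarrow> 'v \<Rightarrow> real"
  assumes E: "E = restrict_space borel S"
    and chain: "markov_chain M E P X"
    and ergodic: "harris_ergodic E P \<pi>"
    and estimators:
      "\<And>n. 1 \<le> n \<Longrightarrow> computed_from_first M E X n (theta_hat n)"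
      "\<And>n. 1 \<le> n \<Longrightarrow> computed_from_first M E X n (sigma_hat n)"
      "\<And>n. 1 \<le> n \<Longrightarrow> computed_from_first M E X n (lambda_hat n)"
    and nonneg:
      "\<And>n \<omega>. 1 \<le> n \<Longrightarrow> \<omega> \<in> space M \<Longrightarrow> 0 \<le> sigma_hat n \<omega>"
      "\<And>n \<omega>. 1 \<le> n \<Longrightarrow> \<omega> \<in> space M \<Longrightarrow> 0 \<le> lambda_hat n \<omega>"
    and \<delta>: "0 < \<delta>" "\<delta> < 1"
    and z: "measure std_normal_distribution {z<..} = \<delta> / 2"
    and p_pos: "\<And>n. 1 \<le> n \<Longrightarrow> 0 < p n"
    and p_decreasing: "antimono_on {1..} p"
    and p_small: "p \<in> o(\<lambda>n. real n powr (- 1 / 2))"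
    and \<sigma>: "0 < \<sigma>"
    and brownian: "standard_brownian_motion N B"
    and FCLT: "fclt M theta_hat \<theta> \<sigma> N B"
    and lambda: "0 < lambda"
    and lambda_hat: "AE \<omega> in M. (\<lambda>n. lambda_hat n \<omega>) \<longlonglongrightarrow> lambda"
    and sigma_hat: "AE \<omega> in M. (\<lambda>n. sigma_hat n \<omega>) \<longlonglongrightarrow> \<sigma>"
  shows "(\<forall>\<epsilon>>0. measure M {\<omega> \<in> space M. T3 z sigma_hat lambda_hat p \<epsilon> \<omega> < \<infinity>} = 1) \<and>
    ((\<lambda>\<epsilon>. measure M {\<omega> \<in> space M.
        \<theta> \<in> conf_interval z theta_hat sigma_hat (the_enat (T3 z sigma_hat lambda_hat p \<epsilon> \<omega>)) \<omega>})
      \<longlongrightarrow> 1 - \<delta>) (at_right 0)"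
proof (intro conjI allI impI)
  have M: "prob_space M" and X: "\<And>n. X n \<in> M \<rightarrow>\<^sub>M E"
    using chain by (auto simp: markov_chain_def)
  interpret M: prob_space M by fact
  note meas = estimators[THEN computed_from_first_measurable[OF X]]
  note p = sqrt_mult_tendsto_0_if_smallo[OF p_small]
  show "M.prob {\<omega> \<in> space M. T3 z sigma_hat lambda_hat p \<epsilon> \<omega> < \<infinity>} = 1" if \<epsilon>: "0 < \<epsilon>" for \<epsilon>
  proof -
    have "AE \<omega> in M. T3 z sigma_hat lambda_hat p \<epsilon> \<omega> < \<infinity>"
      using lambda_hat sigma_hat
    proof eventually_elim
      case (elim \<omega>)
      from rule_met_eventually[OF elim(2,1) lambda \<epsilon> p, of z] show ?case
        by (auto simp: T3_conv_Least eventually_sequentially)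
    qed
    moreover note T3_measurable[OF meas(2,3), measurable]
    have "{\<omega> \<in> space M. T3 z sigma_hat lambda_hat p \<epsilon> \<omega> < \<infinity>} \<in> sets M"
      by measurable
    ultimately show ?thesis by (simp add: M.prob_Collect_eq_1)
  qed
  show "((\<lambda>\<epsilon>. M.prob {\<omega> \<in> space M.
        \<theta> \<in> conf_interval z theta_hat sigma_hat (the_enat (T3 z sigma_hat lambda_hat p \<epsilon> \<omega>)) \<omega>})
      \<longlongrightarrow> 1 - \<delta>) (at_right 0)"
    by (rule tendsto_at_right_sequentially[OF zero_less_one])
       (rule coverage_along_sequence[OF M meas nonneg(1) \<delta>(2) z p_pos p \<sigma> brownian FCLT lambda
          lambda_hat sigma_hat])
qed

end
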